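(* Let $0<b_1<b_2<1$ and let $\mathcal C$ be any subset of $\mathbb Z\times\mathbb Z_{\ge 0}$. Let $(\eta_t)_{t\ge 0}$ be the $\mathcal C$-censored (shifted) stochastic six-vertex process with parameters $b_1,b_2$ started from $\eta_0=\mathbf 1_{x>0}$. Then for every time $t\in\mathbb Z_{\ge0}$ the law of $\eta_t$ is stochastically dominated by the blocking measure $\pi$, i.e. $\mathrm{Law}(\eta_t)\preceq\pi$.
   Context: Stochastic six-vertex model. Vertices are $(x,t)\in\mathbb Z\times\mathbb Z_{\ge0}$. Each vertex has two incoming edges (from the left and from below) and two outgoing edges (to the right and upwards); each edge is either occupied by a path or empty. Given an initial condition $\eta_0:\mathbb Z\to\{0,1\}$ with $\eta_0(x)=0$ for all sufficiently negative $x$, the edge below $(x,0)$ is occupied iff $\eta_0(x)=1$, and no path comes in from $-\infty$ on a horizontal line. The configuration is sampled line by line ($t=0,1,2,\dots$), and on each line from left to right, with independent choices at the vertices as follows: - if both incoming edges are occupied, both outgoing edges are occupied; if both are empty, both outgoing edges are empty; - if only the edge from below is occupied, then with probability $b_1$ the path goes straight (exits upwards) and with probability $1-b_1$ it turns (exits to the right); - if only the edge from the left is occupied, then with probability $b_2$ the path goes straight (exits to the right) and with probability $1-b_2$ it turns (exits upwards). The (shifted) stochastic six-vertex process is $(\eta_t)_{t\ge0}$, where $\eta_t(x)=1$ if the edge below the vertex $(x+t,t)$ is occupied and $\eta_t(x)=0$ otherwise. Censoring. For a set $\mathcal C\subset\mathbb Z\times\mathbb Z_{\ge0}$, the $\mathcal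 C$-censored process is defined by the same dynamics, except that at vertices in $\mathcal C$ at which exactly one incoming edge is occupied the path always turns (never goes straight). Let $A=\{\eta:\mathbb Z\to\{0,1\}:\sum_{x\le 0}\eta(x)=\sum_{x\ge1}(1-\eta(x))<\infty\}$. With $q=b_1/b_2\in(0,1)$, let $\hat\pi=\bigotimes_{x\in\mathbb Z}\mathrm{Ber}\!\left(\frac{q^{-x}}{1+q^{-x}}\right)$; the blocking measure is $\pi(\cdot)=\hat\pi(\cdot\mid A)$. For $\eta\in A$ the height function $h_\eta:\mathbb Z\to\mathbb Z$ is defined by $\lim_{x\to-\infty}h_\eta(x)=0$ and $h_\eta(x+1)-h_\eta(x)=\eta(x)$. For probability measures $\mu,\nu$ on $A$, $\mu$ stochastically dominates $\nu$, written $\nu\preceq\mu$, if there is a coupling $(\eta,\xi)$ with $\eta\sim\mu$, $\xi\sim\nu$ such that $h_\xi(x)\le h_\eta(x)$ for all $x$. *)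

theory Defs
  imports "HOL-Probability.Probability"
begin

type_synonym config = "int \<Rightarrow> bool"

definition config_space :: "config measure" where
  "config_space = PiM UNIV (\<lambda>_. count_space UNIV)"

subsection \<open>The censored stochastic six-vertex model\<close>

text \<open>
  \<open>vertex s below left\<close> is the pair (upper edge, right edge) of outgoing occupations.
  The components of \<open>s\<close> say whether a single path entering from below, respectively
  from the left, goes straight; at most one of them is consulted.
\<close>

fun vertex :: "bool \<times> bool \<Rightarrow> bool \<Rightarrow> bool \<Rightarrow> bool \<times> bool" where
  "vertex s True True = (True, True)"
| "vertex s False False = (False, False)"
| "vertex s True False = (fst s, \<not> fst s)"
| "vertex s False True = (\<not> snd s, snd s)"

text \<open>
  Occupation of the horizontal edges entering the vertices of one line from the left, given the
  vertical edges \<open>v\<close> entering from below and the choices \<open>s\<close> made at the vertices.  The first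
  condition says that no path comes in from \<open>-\<infinity>\<close>.  It determines the edges whenever
  \<open>v\<close> is empty to the far left; see \<open>is_horizontal_ex1\<close>.
\<close>

definition is_horizontal :: "(int \<Rightarrow> bool \<times> bool) \<Rightarrow> config \<Rightarrow> (int \<Rightarrow> bool) \<Rightarrow> bool" where
  "is_horizontal s v h \<longleftrightarrow>
     (\<exists>m. \<forall>x\<le>m. \<not> h x) \<and> (\<forall>x. h (x + 1) = snd (vertex (s x) (v x) (h x)))"

definition horizontal :: "(int \<Rightarrow> bool \<times> bool) \<Rightarrow> config \<Rightarrow> int \<Rightarrow> bool" where
  "horizontal s v = (THE h. is_horizontal s v h)"

definition choice_at :: "(int \<times> nat) set \<Rightarrow> (int \<times> nat \<Rightarrow> bool \<times> bool) \<Rightarrow> int \<times> nat \<Rightarrow> bool \<times> bool" where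
  "choice_at C \<omega> z = (if z \<in> C then (False, False) else \<omega> z)"

text \<open>\<open>vertical C \<eta>\<^sub>0 \<omega> t x\<close>: occupation of the edge below the vertex \<open>(x, t)\<close>.\<close>

primrec vertical ::
  "(int \<times> nat) set \<Rightarrow> config \<Rightarrow> (int \<times> nat \<Rightarrow> bool \<times> bool) \<Rightarrow> nat \<Rightarrow> config" where
  "vertical C \<eta>\<^sub>0 \<omega> 0 = \<eta>\<^sub>0"
| "vertical C \<eta>\<^sub>0 \<omega> (Suc t) =
     (\<lambda>x. fst (vertex (choice_at C \<omega> (x, t)) (vertical C \<eta>\<^sub>0 \<omega> t x)
       (horizontal (\<lambda>y. choice_at C \<omega> (y, t)) (vertical C \<eta>\<^sub>0 \<omega> t) x)))"

definition shifted_s6v ::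
  "(int \<times> nat) set \<Rightarrow> config \<Rightarrow> (int \<times> nat \<Rightarrow> bool \<times> bool) \<Rightarrow> nat \<Rightarrow> config" where
  "shifted_s6v C \<eta>\<^sub>0 \<omega> t = (\<lambda>x. vertical C \<eta>\<^sub>0 \<omega> t (x + int t))"

definition choice_measure :: "real \<Rightarrow> real \<Rightarrow> (int \<times> nat \<Rightarrow> bool \<times> bool) measure" where
  "choice_measure b\<^sub>1 b\<^sub>2 =
     PiM UNIV (\<lambda>_. measure_pmf (pair_pmf (bernoulli_pmf b\<^sub>1) (bernoulli_pmf b\<^sub>2)))"

definition s6v_law ::
  "(int \<times> nat) set \<Rightarrow> real \<Rightarrow> real \<Rightarrow> config \<Rightarrow> nat \<Rightarrow> config measure" where
  "s6v_law C b\<^sub>1 b\<^sub>2 \<eta>\<^sub>0 t =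
     distr (choice_measure b\<^sub>1 b\<^sub>2) config_space (\<lambda>\<omega>. shifted_s6v C \<eta>\<^sub>0 \<omega> t)"

subsection \<open>The blocking measure\<close>

definition configs_A :: "config set" where
  "configs_A = {\<eta>. (\<Sum>\<^sub>\<infinity>x\<in>{..0}. of_bool (\<eta> x) :: ennreal) = (\<Sum>\<^sub>\<infinity>x\<in>{1..}. 1 - of_bool (\<eta> x)) \<and>
                   (\<Sum>\<^sub>\<infinity>x\<in>{..0}. of_bool (\<eta> x) :: ennreal) < \<infinity>}"

definition product_blocking :: "real \<Rightarrow> config measure" where
  "product_blocking q =
     PiM UNIV (\<lambda>x. measure_pmf (bernoulli_pmf (q powi (- x) / (1 + q powi (- x)))))"

text \<open>\<open>uniform_measure M A\<close> is \<open>M\<close> conditioned on \<open>A\<close>.\<close>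

definition blocking :: "real \<Rightarrow> config measure" where
  "blocking q = uniform_measure (product_blocking q) configs_A"

subsection \<open>Height functions and stochastic domination\<close>

definition is_height :: "config \<Rightarrow> (int \<Rightarrow> int) \<Rightarrow> bool" where
  "is_height \<eta> h \<longleftrightarrow> (h \<longlongrightarrow> 0) at_bot \<and> (\<forall>x. h (x + 1) - h x = of_bool (\<eta> x))"

definition height :: "config \<Rightarrow> int \<Rightarrow> int" where
  "height \<eta> = (THE h. is_height \<eta> h)"

definition prob_on_A :: "config measure \<Rightarrow> bool" where
  "prob_on_A \<mu> \<longleftrightarrow> prob_space \<mu> \<and> sets \<mu> = sets config_space \<and> (AE \<eta> in \<mu>. \<eta> \<in> configs_A)"

text \<open>
  A relation between probability measures on \<open>configs_A\<close>: both arguments are required to be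
  such measures. The coupling is given by its joint law \<open>M\<close>.
\<close>

definition stoch_dominated :: "config measure \<Rightarrow> config measure \<Rightarrow> bool" (infix "\<preceq>" 50) where
  "\<nu> \<preceq> \<mu> \<longleftrightarrow> prob_on_A \<nu> \<and> prob_on_A \<mu> \<and>
     (\<exists>M. prob_space M \<and> sets M = sets (config_space \<Otimes>\<^sub>M config_space) \<and>
        distr M config_space fst = \<mu> \<and> distr M config_space snd = \<nu> \<and>
        (AE (\<eta>, \<xi>) in M. \<forall>x. height \<xi> x \<le> height \<eta> x))"

subsection \<open>The definite descriptions are well-defined\<close>

lemma is_horizontal_ex1:
  assumes "\<exists>m. \<forall>x\<le>m. \<not> v x"
  shows "\<exists>!h. is_horizontal s v h"
proof -
  obtain m where m: "\<And>x. x \<le> m \<Longrightarrow> \<not> v x" using assms by blast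
  define g where "g = rec_nat False (\<lambda>n b. snd (vertex (s (m + int n)) (v (m + int n)) b))"
  have g0: "g 0 = False" and gS: "g (Suc n) = snd (vertex (s (m + int n)) (v (m + int n)) (g n))" for n
    by (simp_all add: g_def)
  have ex: "is_horizontal s v (\<lambda>x. g (nat (x - m)))"
    unfolding is_horizontal_def
  proof (intro conjI allI exI[of _ m] impI)
    fix x :: int
    show "\<not> g (nat (x - m))" if "x \<le> m" using that g0 by simp
    show "g (nat (x + 1 - m)) = snd (vertex (s x) (v x) (g (nat (x - m))))"
    proof (cases "x < m")
      case True
      then show ?thesis using m[of x] g0 by simp
    next
      case False
      then have "nat (x + 1 - m) = Suc (nat (x - m))" "m + int (nat (x - m)) = x" by auto
      then show ?thesis using gS[of "nat (x - m)"] by simp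
    qed
  qed
  have "h x = h' x" if h: "is_horizontal s v h" and h': "is_horizontal s v h'" for h h' x
  proof -
    obtain k where k: "\<And>x. x \<le> k \<Longrightarrow> \<not> h x" using h unfolding is_horizontal_def by blast
    obtain k' where k': "\<And>x. x \<le> k' \<Longrightarrow> \<not> h' x" using h' unfolding is_horizontal_def by blast
    have step: "h (x + 1) = snd (vertex (s x) (v x) (h x))"
               "h' (x + 1) = snd (vertex (s x) (v x) (h' x))" for x
      using h h' unfolding is_horizontal_def by auto
    have "h y = h' y" if "min k k' \<le> y" for y
      using that by (induction y rule: int_ge_induct) (use k k' in \<open>auto simp: step\<close>)
    moreover have "h y = h' y" if "y \<le> min k k'" for y
      using that k k' by auto
    ultimately show ?thesis by (meson linear)
  qed
  then show ?thesis using ex by blast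
qed

lemma vertical_left_empty:
  assumes "\<exists>m. \<forall>x\<le>m. \<not> \<eta>\<^sub>0 x"
  shows "\<exists>m. \<forall>x\<le>m. \<not> vertical C \<eta>\<^sub>0 \<omega> t x"
proof (induction t)
  case 0
  then show ?case using assms by simp
next
  case (Suc t)
  let ?v = "vertical C \<eta>\<^sub>0 \<omega> t" and ?s = "\<lambda>y. choice_at C \<omega> (y, t)"
  have "is_horizontal ?s ?v (horizontal ?s ?v)"
    unfolding horizontal_def using is_horizontal_ex1[OF Suc] by (rule theI')
  then obtain k where k: "\<And>x. x \<le> k \<Longrightarrow> \<not> horizontal ?s ?v x"
    unfolding is_horizontal_def by blast
  obtain m where m: "\<And>x. x \<le> m \<Longrightarrow> \<not> ?v x" using Suc by blast
  show ?case by (rule exI[of _ "min k m"]) (auto simp: k m)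
qed

lemma is_height_ex1:
  assumes "finite {x. x \<le> 0 \<and> \<eta> x}"
  shows "\<exists>!h. is_height \<eta> h"
proof -
  have "\<exists>m. \<forall>x\<le>m. \<not> \<eta> x"
  proof -
    obtain b where b: "\<And>x. x \<in> {x. x \<le> 0 \<and> \<eta> x} \<Longrightarrow> b \<le> x"
      using bdd_below_finite[OF assms] by (meson bdd_below.E)
    then show ?thesis by (intro exI[of _ "min (b - 1) 0"]) force
  qed
  then obtain m where m: "\<And>x. x \<le> m \<Longrightarrow> \<not> \<eta> x" by blast
  define h where "h = (\<lambda>x. \<Sum>y\<in>{m..<x}. of_bool (\<eta> y) :: int)"
  have ex: "is_height \<eta> h"
    unfolding is_height_def
  proof (intro conjI allI)
    show "(h \<longlongrightarrow> 0) at_bot"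
      by (rule tendsto_eventually) (auto simp: eventually_at_bot_linorder h_def intro!: exI[of _ m])
    fix x :: int
    show "h (x + 1) - h x = of_bool (\<eta> x)"
    proof (cases "x < m")
      case True
      then show ?thesis using m[of x] by (simp add: h_def)
    next
      case False
      then have "{m..<x + 1} = insert x {m..<x}" by auto
      then show ?thesis by (simp add: h_def)
    qed
  qed
  have "f x = f' x" if f: "is_height \<eta> f" and f': "is_height \<eta> f'" for f f' x
  proof -
    have "eventually (\<lambda>x. f x = 0 \<and> f' x = 0) at_bot"
      using f f' by (auto simp: is_height_def tendsto_discrete eventually_conj)
    then obtain k where k: "\<And>x. x \<le> k \<Longrightarrow> f x = 0 \<and> f' x = 0"
      unfolding eventually_at_bot_linorder by blast
    have step: "f (x + 1) - f x = f' (x + 1) - f' x" for x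
      using f f' unfolding is_height_def by auto
    have "f y = f' y" if "k \<le> y" for y
      using that
    proof (induction y rule: int_ge_induct)
      case base
      then show ?case using k by simp
    next
      case (step i)
      then show ?case using \<open>\<And>x. f (x + 1) - f x = f' (x + 1) - f' x\<close>[of i] by simp
    qed
    moreover have "f y = f' y" if "y \<le> k" for y using k that by simp
    ultimately show ?thesis by (meson linear)
  qed
  then show ?thesis using ex by blast
qed

end

theory Submission
  imports Defs "HOL-Complex_Analysis.Great_Picard"
begin

text \<open>
  In shifted coordinates the vertex \<open>(x, t)\<close> acts on the edge between the sites \<open>x - t - 1\<close> and
  \<open>x - t\<close>: it changes only the height at \<open>s = x - t\<close>, raising a lower corner with probability \<open>b\<^sub>1\<close>
  and lowering an upper corner with probability \<open>b\<^sub>2\<close>.  For \<open>b\<^sub>1 + b\<^sub>2 > 1\<close> this update is not monotone,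
  so it cannot be coupled directly with the stationary dynamics.  It is however a mixture of the identity
  and of the update \<open>T s\<close> with probabilities \<open>q = b\<^sub>1 / b\<^sub>2\<close> and \<open>1\<close>, and the \<open>T s\<close> generate a Hecke algebra.
  The product \<open>R e\<close> of all \<open>T s\<close> with \<open>s \<le> e\<close>, taken from left to right, is monotone: it is
  \<open>h x \<mapsto> \<phi> (h (x + 1))\<close> for \<open>x \<le> e\<close>, where \<open>\<phi>\<close> is a random monotone function, the same for all \<open>x\<close>.
  By the Hecke relations \<open>T s\<close> turns a product of \<open>R\<close>'s applied to the step configuration into a mixture of
  such products.  Since the blocking measure is invariant under \<open>T s\<close>, hence under \<open>R e\<close>, and the step
  configuration is the lowest one, all these mixtures are dominated by the blocking measure.

  Infinite lines are reached by censoring also the vertices beyond column \<open>n\<close>: almost surely this does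
  not change the configuration at time \<open>t\<close> for large \<open>n\<close>, and couplings of countably supported laws pass
  to the limit along a subsequence.
\<close>

subsection \<open>Local updates of height functions\<close>

definition height_functions :: "(int \<Rightarrow> int) set" where
  "height_functions = {h. (\<forall>x. h (x + 1) = h x \<or> h (x + 1) = h x + 1) \<and> (\<exists>m. \<forall>x\<le>m. h x = 0)}"

lemma height_functionsD:
  assumes "h \<in> height_functions"
  shows "h (x + 1) = h x \<or> h (x + 1) = h x + 1" "h x = h (x - 1) \<or> h x = h (x - 1) + 1"
  using assms spec[of "\<lambda>x. h (x + 1) = h x \<or> h (x + 1) = h x + 1" "x - 1"]
  by (auto simp: height_functions_def)

lemma height_functions_mono:
  assumes "h \<in> height_functions" "x \<le> y"
  shows "h x \<le> h y"
  using assms(2)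
proof (induction y rule: int_ge_induct)
  case (step i)
  then show ?case using height_functionsD(1)[OF assms(1), of i] by linarith
qed simp

lemma height_functions_nonneg:
  assumes "h \<in> height_functions"
  shows "0 \<le> h x"
proof -
  obtain m where "\<forall>x\<le>m. h x = 0" using assms by (auto simp: height_functions_def)
  then have "h (min m x) = 0" by simp
  then show ?thesis using height_functions_mono[OF assms, of "min m x" x] by simp
qed

text \<open>As in \<open>vertex\<close>, the components of \<open>c\<close> mean going straight.
  Going straight flips the corner at \<open>s\<close> and turning keeps it, so the choice
  \<open>(False, False)\<close> of a censored vertex acts as the identity.\<close>

definition flip :: "int \<Rightarrow> bool \<times> bool \<Rightarrow> (int \<Rightarrow> int) \<Rightarrow> int \<Rightarrow> int" where
  "flip s c h = (if h (s + 1) = h (s - 1) + 1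
     then h(s := h (s - 1) + of_bool (if h s = h (s - 1) then fst c else \<not> snd c)) else h)"

lemma flip_in_height_functions:
  assumes h: "h \<in> height_functions"
  shows "flip s c h \<in> height_functions"
proof (cases "h (s + 1) = h (s - 1) + 1")
  case True
  obtain m where m: "\<forall>x\<le>m. h x = 0" using h by (auto simp: height_functions_def)
  have "flip s c h (x + 1) = flip s c h x \<or> flip s c h (x + 1) = flip s c h x + 1" for x
    using height_functionsD[OF h, of x] True by (auto simp: flip_def)
  moreover have "\<forall>x\<le>min m (s - 1). flip s c h x = 0" using m by (auto simp: flip_def)
  ultimately show ?thesis unfolding height_functions_def by blast
qed (simp add: flip_def h)

text \<open>
  On configurations: the sites up to \<open>e\<close> shift left by one, and the particle with \<open>n\<close> particles to its
  left, if it is among them, is taken out and put back at site \<open>e\<close>.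
\<close>

definition eject_particle :: "nat \<Rightarrow> int \<Rightarrow> (int \<Rightarrow> int) \<Rightarrow> int \<Rightarrow> int" where
  "eject_particle n e h x = (if x \<le> e then (if h (x + 1) \<le> int n then h (x + 1) else h (x + 1) - 1) else h x)"

lemma eject_particle_in_height_functions:
  assumes h: "h \<in> height_functions"
  shows "eject_particle n e h \<in> height_functions"
proof -
  obtain m where m: "\<forall>x\<le>m. h x = 0" using h by (auto simp: height_functions_def)
  have "eject_particle n e h (x + 1) = eject_particle n e h x \<or> eject_particle n e h (x + 1) = eject_particle n e h x + 1" for x
    using height_functionsD(1)[OF h, of x] height_functionsD(1)[OF h, of "x + 1"] 
    by (auto simp: eject_particle_def)
  moreover have "\<forall>x\<le>m - 1. eject_particle n e h x = 0" using m by (auto simp: eject_particle_def)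
  ultimately show ?thesis unfolding height_functions_def by blast
qed

text \<open>The map sending a height \<open>v\<close> to \<open>v\<close> if
  \<open>v \<le> int n\<close> and to \<open>v - 1\<close> otherwise is nondecreasing and is the
  same at every site. This is the monotonicity that the single update \<open>hecke q s\<close>
  lacks.\<close>

lemma eject_particle_mono:
  assumes "h \<le> k"
  shows "eject_particle n e h \<le> eject_particle n e k"
proof (rule le_funI)
  fix x
  show "eject_particle n e h x \<le> eject_particle n e k x"
    using le_funD[OF assms, of x] le_funD[OF assms, of "x + 1"] by (simp add: eject_particle_def)
qed

text \<open>
  The operators \<open>T s\<close> and \<open>R e\<close> of the introduction.  Under \<open>R e\<close> the hole entering from the left passes each
  particle with probability \<open>q\<close>, so the particle that stops it has a geometric index.
\<close>

definition hecke :: "real \<Rightarrow> int \<Rightarrow> (int \<Rightarrow> int) \<Rightarrow> (int \<Rightarrow> int) pmf" where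
  "hecke q s h = map_pmf (\<lambda>u. flip s (u, True) h) (bernoulli_pmf q)"

definition row_pmf :: "real \<Rightarrow> int \<Rightarrow> (int \<Rightarrow> int) \<Rightarrow> (int \<Rightarrow> int) pmf" where
  "row_pmf q e h = map_pmf (\<lambda>n. eject_particle n e h) (geometric_pmf (1 - q))"

section \<open>Mixtures over a geometric index\<close>

lemma pmf_bind_bernoulli:
  assumes "0 \<le> p" "p \<le> 1"
  shows "pmf (bernoulli_pmf p \<bind> f) i = p * pmf (f True) i + (1 - p) * pmf (f False) i"
  using assms by (simp add: pmf_bind)

lemma pmf_bind_geometric:
  assumes "0 < q" "q < 1"
  shows "pmf (geometric_pmf (1 - q) \<bind> f) i = (1 - q) * pmf (f 0) i + q * pmf (geometric_pmf (1 - q) \<bind> (\<lambda>n. f (Suc n))) i"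
proof -
  have "geometric_pmf (1 - q) \<bind> f = bernoulli_pmf (1 - q) \<bind>
      (\<lambda>b. (if b then return_pmf 0 else map_pmf Suc (geometric_pmf (1 - q))) \<bind> f)"
    using assms by (subst geometric_bind_pmf_unfold) (simp_all add: bind_assoc_pmf)
  then show ?thesis
    using assms by (simp add: pmf_bind_bernoulli bind_map_pmf bind_return_pmf)
qed

text \<open>Indices below \<open>a\<close> contribute equally on both sides and can be peeled off
  one by one; by lack of memory the rest is again a geometric mixture.\<close>

lemma bind_geometric_shift:
  assumes q: "0 < q" "q < 1"
  assumes "\<And>n. n < a \<Longrightarrow> f n = g n"
    and "geometric_pmf (1 - q) \<bind> (\<lambda>n. f (n + a)) = geometric_pmf (1 - q) \<bind> (\<lambda>n. g (n + a))"
  shows "geometric_pmf (1 - q) \<bind> f = geometric_pmf (1 - q) \<bind> g"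
  using assms(3,4)
proof (induction a arbitrary: f g)
  case (Suc a)
  have "geometric_pmf (1 - q) \<bind> (\<lambda>n. f (Suc n)) = geometric_pmf (1 - q) \<bind> (\<lambda>n. g (Suc n))"
    using Suc.prems by - (rule Suc.IH, simp_all)
  then show ?case
    using Suc.prems(1)[of 0] by (intro pmf_eqI) (simp add: pmf_bind_geometric[OF q, of f] pmf_bind_geometric[OF q, of g])
qed simp

text \<open>Relative to the weight of \<open>a\<close>, the weight of \<open>Suc a\<close> is
  \<open>q\<close>. On both sides these two indices together then give \<open>u\<close> the weight 1
  and \<open>v\<close> the weight \<open>q\<close>.\<close>

lemma bind_geometric_swap:
  assumes q: "0 < q" "q < 1"
  assumes eq: "\<And>n. n \<noteq> a \<Longrightarrow> n \<noteq> Suc a \<Longrightarrow> f n = g n"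
    and fg: "f a = bernoulli_pmf q \<bind> (\<lambda>b. if b then v else u)" "f (Suc a) = u" "g a = u" "g (Suc a) = v"
  shows "geometric_pmf (1 - q) \<bind> f = geometric_pmf (1 - q) \<bind> g"
proof (rule bind_geometric_shift[OF q, where a = a])
  show "geometric_pmf (1 - q) \<bind> (\<lambda>n. f (n + a)) = geometric_pmf (1 - q) \<bind> (\<lambda>n. g (n + a))"
  proof (rule pmf_eqI)
    fix i
    have *: "pmf (geometric_pmf (1 - q) \<bind> (\<lambda>n. w (n + a))) i = (1 - q) * pmf (w a) i +
        q * ((1 - q) * pmf (w (Suc a)) i + q * pmf (geometric_pmf (1 - q) \<bind> (\<lambda>n. w (Suc (Suc n) + a))) i)"
      for w :: "nat \<Rightarrow> 'a pmf"
      using pmf_bind_geometric[OF q, of "\<lambda>n. w (n + a)" i]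
        pmf_bind_geometric[OF q, of "\<lambda>n. w (Suc n + a)" i] by simp
    show "pmf (geometric_pmf (1 - q) \<bind> (\<lambda>n. f (n + a))) i = pmf (geometric_pmf (1 - q) \<bind> (\<lambda>n. g (n + a))) i"
      unfolding * using q eq by (simp add: fg pmf_bind_bernoulli algebra_simps)
  qed
qed (use eq in auto)

text \<open>Given that the index is at least \<open>a\<close>, it equals \<open>a\<close> with
  probability \<open>1 - q\<close> and lies beyond with probability \<open>q\<close>; only this
  average has to agree.\<close>

lemma bind_geometric_tail:
  assumes q: "0 < q" "q < 1"
  assumes eq: "\<And>n. n < a \<Longrightarrow> f n = g n"
    and fa: "\<And>n. a < n \<Longrightarrow> f n = f'" and ga: "\<And>n. a < n \<Longrightarrow> g n = g'"
    and fg: "\<And>i. (1 - q) * pmf (f a) i + q * pmf f' i = (1 - q) * pmf (g a) i + q * pmf g' i"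
  shows "geometric_pmf (1 - q) \<bind> f = geometric_pmf (1 - q) \<bind> g"
proof (rule bind_geometric_shift[OF q, where a = a])
  show "geometric_pmf (1 - q) \<bind> (\<lambda>n. f (n + a)) = geometric_pmf (1 - q) \<bind> (\<lambda>n. g (n + a))"
  proof (rule pmf_eqI)
    fix i
    have *: "pmf (geometric_pmf (1 - q) \<bind> (\<lambda>n. w (n + a))) i =
        (1 - q) * pmf (w a) i + q * pmf (geometric_pmf (1 - q) \<bind> (\<lambda>n. w (Suc n + a))) i"
      for w :: "nat \<Rightarrow> 'a pmf"
      using pmf_bind_geometric[OF q, of "\<lambda>n. w (n + a)" i] by simp
    show "pmf (geometric_pmf (1 - q) \<bind> (\<lambda>n. f (n + a))) i = pmf (geometric_pmf (1 - q) \<bind> (\<lambda>n. g (n + a))) i"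
      unfolding * by (simp add: fa ga fg)
  qed
qed (use eq in auto)

subsection \<open>Commutation of local updates with row operators\<close>

lemma row_pmf_bind: "row_pmf q e h \<bind> f = geometric_pmf (1 - q) \<bind> (\<lambda>n. f (eject_particle n e h))"
  by (simp add: row_pmf_def bind_map_pmf)

lemma bind_row_pmf: "p \<bind> row_pmf q e = geometric_pmf (1 - q) \<bind> (\<lambda>n. map_pmf (eject_particle n e) p)"
  unfolding row_pmf_def map_pmf_def by (rule bind_commute_pmf)

lemma hecke_lower:
  assumes "h (s + 1) = h (s - 1) + 1" "h s = h (s - 1)"
  shows "hecke q s h = bernoulli_pmf q \<bind> (\<lambda>b. if b then return_pmf (h(s := h s + 1)) else return_pmf h)"
proof -
  have "flip s (u, True) h = (if u then h(s := h s + 1) else h)" for u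
    using assms by (auto simp: flip_def)
  then show ?thesis
    by (auto simp: hecke_def map_pmf_def intro!: bind_pmf_cong)
qed

lemma hecke_upper:
  assumes "h (s + 1) = h (s - 1) + 1" "h s = h (s - 1) + 1"
  shows "hecke q s h = return_pmf (h(s := h s - 1))"
  using assms by (simp add: hecke_def flip_def map_pmf_const)

lemma hecke_fixed:
  assumes "h (s + 1) \<noteq> h (s - 1) + 1"
  shows "hecke q s h = return_pmf h"
  using assms by (simp add: hecke_def flip_def map_pmf_const)

text \<open>If site \<open>e + 1\<close> is empty, a particle put at \<open>e\<close> by
  \<open>R e\<close> is pushed on to \<open>e + 1\<close>. If site \<open>e + 1\<close> holds a
  particle, its index is \<open>a = h (e + 1)\<close>. For \<open>n < a\<close> a particle already
  sits at \<open>e\<close> and nothing can move. For \<open>n \<ge> a\<close> site \<open>e\<close>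
  is empty, and the particle moves left with probability \<open>q\<close>, which is the probability
  of \<open>n > a\<close> given \<open>n \<ge> a\<close>.\<close>

lemma hecke_row_next:
  assumes q: "0 < q" "q < 1" and h: "h \<in> height_functions"
  shows "row_pmf q e h \<bind> hecke q (e + 1) = row_pmf q (e + 1) h"
proof (cases "h (2 + e) = h (e + 1) + 1")
  case False
  then have eq: "h (2 + e) = h (e + 1)"
    using height_functionsD(1)[OF h, of "e + 1"] by simp
  have "hecke q (e + 1) (eject_particle n e h) = return_pmf (eject_particle n (e + 1) h)" for n
  proof -
    have "flip (e + 1) c (eject_particle n e h) = eject_particle n (e + 1) h" if "snd c" for c
    proof
      fix x
      show "flip (e + 1) c (eject_particle n e h) x = eject_particle n (e + 1) h x"
        using eq that by (cases "x = e + 1") (auto simp: flip_def eject_particle_def)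
    qed
    then show ?thesis by (simp add: hecke_def map_pmf_const)
  qed
  then show ?thesis unfolding row_pmf_bind by (simp add: map_pmf_def row_pmf_def)
next
  case True
  define a where "a = nat (h (e + 1))"
  have a: "h (e + 1) = int a" using height_functions_nonneg[OF h] by (simp add: a_def)
  have le_a: "h x \<le> int a" if "x \<le> e + 1" for x
    using height_functions_mono[OF h that] a by simp
  have ins: "eject_particle n e h = eject_particle a e h" if "a < n" for n
  proof
    fix x
    show "eject_particle n e h x = eject_particle a e h x"
      using that le_a[of "x + 1"] by (auto simp: eject_particle_def)
  qed
  have hole: "eject_particle a (e + 1) h = eject_particle a e h"
  proof
    fix x
    show "eject_particle a (e + 1) h x = eject_particle a e h x"
      using a True by (cases "x = e + 1") (auto simp: eject_particle_def)
  qed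
  have up: "eject_particle n (e + 1) h = (eject_particle a e h)(e + 1 := int a + 1)" if "a < n" for n
  proof
    fix x
    show "eject_particle n (e + 1) h x = ((eject_particle a e h)(e + 1 := int a + 1)) x"
      using that a True le_a[of "x + 1"] by (auto simp: eject_particle_def)
  qed
  have lower: "hecke q (e + 1) (eject_particle a e h) = bernoulli_pmf q \<bind>
      (\<lambda>b. if b then return_pmf ((eject_particle a e h)(e + 1 := int a + 1)) else return_pmf (eject_particle a e h))"
  proof -
    have "eject_particle a e h (e + 1) = int a" "eject_particle a e h e = int a"
      "eject_particle a e h (e + 1 + 1) = int a + 1"
      using a True by (simp_all add: eject_particle_def)
    then show ?thesis
      using hecke_lower[of "eject_particle a e h" "e + 1" q] by (simp cong: if_cong)
  qed
  have "geometric_pmf (1 - q) \<bind> (\<lambda>n. hecke q (e + 1) (eject_particle n e h)) =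
      geometric_pmf (1 - q) \<bind> (\<lambda>n. return_pmf (eject_particle n (e + 1) h))"
  proof (rule bind_geometric_tail[OF q, where a = a])
    fix n assume n: "n < a"
    have same: "eject_particle n (e + 1) h = eject_particle n e h"
    proof
      fix x
      show "eject_particle n (e + 1) h x = eject_particle n e h x"
        using n a True by (cases "x = e + 1") (simp_all add: eject_particle_def)
    qed
    have "eject_particle n e h (e + 1 + 1) \<noteq> eject_particle n e h (e + 1 - 1) + 1"
      using n a True by (simp add: eject_particle_def)
    then show "hecke q (e + 1) (eject_particle n e h) = return_pmf (eject_particle n (e + 1) h)"
      unfolding same by (rule hecke_fixed)
  next
    fix n assume n: "a < n"
    show "hecke q (e + 1) (eject_particle n e h) = hecke q (e + 1) (eject_particle a e h)"
      by (simp add: ins n)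
    show "return_pmf (eject_particle n (e + 1) h) = return_pmf ((eject_particle a e h)(e + 1 := int a + 1))"
      by (simp add: up n)
  next
    fix i
    show "(1 - q) * pmf (hecke q (e + 1) (eject_particle a e h)) i + q * pmf (hecke q (e + 1) (eject_particle a e h)) i =
      (1 - q) * pmf (return_pmf (eject_particle a (e + 1) h)) i +
      q * pmf (return_pmf ((eject_particle a e h)(e + 1 := int a + 1))) i"
      unfolding lower hole using q by (simp add: pmf_bind_bernoulli algebra_simps)
  qed
  then show ?thesis unfolding row_pmf_bind by (simp add: map_pmf_def row_pmf_def)
qed

text \<open>\<open>eject_particle n e\<close> computes new heights up to \<open>e\<close> from those
  up to \<open>e + 1\<close>, while \<open>flip s\<close> changes only the height at
  \<open>s\<close> and looks only at its neighbours, all beyond \<open>e\<close>.\<close>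

lemma hecke_row_above:
  assumes "e + 1 < s"
  shows "row_pmf q e h \<bind> hecke q s = hecke q s h \<bind> row_pmf q e"
proof -
  have "flip s c (eject_particle n e h) = eject_particle n e (flip s c h)" for n c
    using assms by (auto simp: flip_def eject_particle_def fun_eq_iff)
  then show ?thesis
    by (simp add: row_pmf_bind bind_row_pmf hecke_def map_pmf_comp)
qed

text \<open>\<open>R e\<close> shifts the sites to the left, so a corner at \<open>s + 1\<close>
  reappears at \<open>s\<close>. This gives equality for each index \<open>n\<close>, unless sites
  \<open>s\<close> and \<open>s + 1\<close> are both occupied and one of these two particles, of
  indices \<open>a\<close> and \<open>Suc a\<close>, is ejected. In that case
  \<open>T (s + 1)\<close> does nothing beforehand, while \<open>T s\<close> exchanges the two
  outcomes reversibly with respect to the geometric weights.\<close>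

lemma hecke_row_below:
  assumes q: "0 < q" "q < 1" and h: "h \<in> height_functions" and s: "s < e"
  shows "row_pmf q e h \<bind> hecke q s = hecke q (s + 1) h \<bind> row_pmf q e"
proof -
  define a where "a = nat (h s)"
  have a: "h s = int a" using height_functions_nonneg[OF h] by (simp add: a_def)
  have h1: "h (s + 1) = h s \<or> h (s + 1) = h s + 1" and h2: "h (2 + s) = h (s + 1) \<or> h (2 + s) = h (s + 1) + 1"
    using height_functionsD(1)[OF h, of s] height_functionsD(1)[OF h, of "s + 1"] by auto
  have comm: "flip s c (eject_particle n e h) = eject_particle n e (flip (s + 1) c h)"
    if "h (2 + s) \<noteq> h s + 2 \<or> n \<noteq> a \<and> n \<noteq> Suc a" for n c
  proof
    fix x
    show "flip s c (eject_particle n e h) x = eject_particle n e (flip (s + 1) c h) x"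
    proof (cases "x = s")
      case True
      let ?k = "eject_particle n e h"
      have k: "?k (s - 1) = (if a \<le> n then int a else int a - 1)"
        "?k s = (if h (s + 1) \<le> int n then h (s + 1) else h (s + 1) - 1)"
        "?k (s + 1) = (if h (2 + s) \<le> int n then h (2 + s) else h (2 + s) - 1)"
        using s a by (simp_all add: eject_particle_def)
      have l: "flip s c ?k s = (if ?k (s + 1) = ?k (s - 1) + 1
          then ?k (s - 1) + of_bool (if ?k s = ?k (s - 1) then fst c else \<not> snd c) else ?k s)"
        by (simp add: flip_def)
      have f: "flip (s + 1) c h (s + 1) = (if h (2 + s) = int a + 1
          then int a + of_bool (if h (s + 1) = int a then fst c else \<not> snd c) else h (s + 1))"
        using a by (simp add: flip_def)
      have r: "eject_particle n e (flip (s + 1) c h) s =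
          (if flip (s + 1) c h (s + 1) \<le> int n then flip (s + 1) c h (s + 1) else flip (s + 1) c h (s + 1) - 1)"
        using s by (simp add: eject_particle_def)
      show ?thesis
      proof (cases "h (s + 1) = int a")
        case low: True
        show ?thesis
        proof (cases "h (2 + s) = int a")
          case True
          then show ?thesis unfolding \<open>x = s\<close> l r f k low True by simp
        next
          case False
          then have "h (2 + s) = int a + 1" using low h2 by simp
          then show ?thesis unfolding \<open>x = s\<close> l r f k low
            by (cases "fst c"; cases "n < a"; cases "n = a") simp_all
        qed
      next
        case False
        then have high: "h (s + 1) = int a + 1" using h1 a by simp
        show ?thesis
        proof (cases "h (2 + s) = int a + 1")
          case True
          then show ?thesis unfolding \<open>x = s\<close> l r f k high
            by (cases "snd c"; cases "n < a"; cases "n = a") simp_all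
        next
          case False
          then have "h (2 + s) = int a + 2" using high h2 by simp
          moreover have "n < a \<or> Suc a < n" using calculation that a by auto
          ultimately show ?thesis unfolding \<open>x = s\<close> l r f k high by auto
        qed
      qed
    next
      case False
      then have "flip s c (eject_particle n e h) x = eject_particle n e h x"
        "flip (s + 1) c h (x + 1) = h (x + 1)" "e < x \<Longrightarrow> flip (s + 1) c h x = h x"
        using s by (simp_all add: flip_def)
      then show ?thesis by (simp add: eject_particle_def)
    qed
  qed
  show ?thesis
  proof (cases "h (2 + s) = h s + 2")
    case False
    then show ?thesis by (simp add: row_pmf_bind bind_row_pmf hecke_def map_pmf_comp comm)
  next
    case True
    then have a1: "h (s + 1) = int a + 1" "h (2 + s) = int a + 2" using h1 h2 a by auto
    have fixed: "hecke q (s + 1) h = return_pmf h"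
      using a1 a by (subst hecke_fixed) (simp_all)
    let ?u = "eject_particle a e h" and ?v = "eject_particle (Suc a) e h"
    have uv: "?u(s := ?u s + 1) = ?v" "?v(s := ?v s - 1) = ?u"
    proof -
      \<comment> \<open>Both sites \<open>s\<close> and \<open>s + 1\<close> are occupied, so the
        height \<open>a + 1\<close> occurs at \<open>s + 1\<close> only; hence the two ejections
        differ only at \<open>s\<close>.\<close>
      have "h (x + 1) \<noteq> int a + 1" if "x \<noteq> s" for x
      proof (cases "x < s")
        case True
        then show ?thesis using height_functions_mono[OF h, of "x + 1" s] a by simp
      next
        case False
        then show ?thesis using that height_functions_mono[OF h, of "2 + s" "x + 1"] a1 by simp
      qed
      then have "?u x = ?v x" if "x \<noteq> s" for x
        using that by (force simp: eject_particle_def)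
      moreover have "?u s = int a" "?v s = int a + 1"
        using s a a1 by (simp_all add: eject_particle_def)
      ultimately show "?u(s := ?u s + 1) = ?v" "?v(s := ?v s - 1) = ?u"
        by (auto simp: fun_eq_iff)
    qed
    have "geometric_pmf (1 - q) \<bind> (\<lambda>n. hecke q s (eject_particle n e h)) =
      geometric_pmf (1 - q) \<bind> (\<lambda>n. return_pmf (eject_particle n e h))"
    proof (rule bind_geometric_swap[OF q, where a = a])
      fix n assume "n \<noteq> a" "n \<noteq> Suc a"
      then show "hecke q s (eject_particle n e h) = return_pmf (eject_particle n e h)"
        using comm[of n] a1 a by (simp add: hecke_def flip_def map_pmf_const)
    next
      show "hecke q s ?u = bernoulli_pmf q \<bind> (\<lambda>b. if b then return_pmf ?v else return_pmf ?u)"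
        unfolding uv(1)[symmetric] using s a a1 by (intro hecke_lower) (simp_all add: eject_particle_def)
      show "hecke q s ?v = return_pmf ?u"
        using s a a1 uv by (subst hecke_upper) (simp_all add: eject_particle_def)
    qed simp_all
    then show ?thesis
      by (simp add: row_pmf_bind bind_row_pmf fixed)
  qed
qed

text \<open>As \<open>R e\<close> is \<open>R (e - 1)\<close> followed by \<open>T e\<close>, this
  expresses the quadratic Hecke relation \<open>T^2 = (1 - q) T + q\<close>. It is verified on the
  index \<open>n\<close>: separately for each \<open>n\<close> if site \<open>e\<close> is empty or
  \<open>n < a\<close>, and otherwise by averaging over the index \<open>a\<close> of the particle
  at \<open>e\<close> and all indices beyond.\<close>

lemma hecke_row_same:
  assumes q: "0 < q" "q < 1" and h: "h \<in> height_functions"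
  shows "row_pmf q e h \<bind> hecke q e = bernoulli_pmf q \<bind> (\<lambda>b. row_pmf q (if b then e - 1 else e) h)"
proof -
  define a where "a = nat (h e)"
  have a: "h e = int a" using height_functions_nonneg[OF h] by (simp add: a_def)
  have le_a: "h x \<le> int a" if "x \<le> e" for x
    using height_functions_mono[OF h that] a by simp
  have h1: "h (e + 1) = h e \<or> h (e + 1) = h e + 1" 
    using height_functionsD(1)[OF h, of e] by auto
  let ?g = "\<lambda>n. bernoulli_pmf q \<bind> (\<lambda>b. return_pmf (eject_particle n (if b then e - 1 else e) h))"
  have R: "bernoulli_pmf q \<bind> (\<lambda>b. row_pmf q (if b then e - 1 else e) h) = geometric_pmf (1 - q) \<bind> ?g"
    unfolding row_pmf_def map_pmf_def by (rule bind_commute_pmf)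
  have g_const: "?g n = return_pmf (eject_particle n e h)" if "eject_particle n (e - 1) h = eject_particle n e h" for n
    by (rule trans[OF bind_pmf_cong[OF refl, where g = "\<lambda>_. return_pmf (eject_particle n e h)"]])
       (auto simp: that)
  have path: "hecke q e (eject_particle n e h) = ?g n" if "h (e + 1) = h e \<or> n < a" for n
  proof (cases "int n < h (e + 1)")
    case True
    have n: "n < a" using True that a by auto
    show ?thesis
    proof (cases "h (e + 1) = h e")
      case True
      have "(eject_particle n e h)(e := eject_particle n e h e + 1) = eject_particle n (e - 1) h"
        using True n a by (auto simp: eject_particle_def fun_eq_iff)
      then show ?thesis using True n a 
        by (subst hecke_lower) (auto simp: eject_particle_def intro!: bind_pmf_cong)
    next
      case False
      then have "h (e + 1) = h e + 1" using h1 by simp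
      moreover have "eject_particle n (e - 1) h = eject_particle n e h"
        using calculation n a by (auto simp: eject_particle_def fun_eq_iff)
      ultimately show ?thesis using n a
        by (subst hecke_fixed) (simp_all add: eject_particle_def g_const)
    qed
  next
    case False
    have eq: "h (e + 1) = h e" using False that a h1 by auto
    moreover have "eject_particle n (e - 1) h = eject_particle n e h"
      using False eq by (auto simp: eject_particle_def fun_eq_iff)
    ultimately show ?thesis using False
      by (subst hecke_fixed) (simp_all add: eject_particle_def g_const)
  qed
  show ?thesis
  proof (cases "h (e + 1) = h e")
    case True
    then show ?thesis by (simp add: row_pmf_bind R path)
  next
    case False
    then have a1: "h (e + 1) = int a + 1" using h1 a by simp
    let ?u = "eject_particle a e h" and ?v = "eject_particle (Suc a) e h"
    have ev: "eject_particle n e h = ?v" "eject_particle n (e - 1) h = ?u" if "a < n" for n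
    proof -
      have "eject_particle n e h x = ?v x \<and> eject_particle n (e - 1) h x = ?u x" for x
        using that le_a[of "x + 1"] a a1 by (auto simp: eject_particle_def)
      then show "eject_particle n e h = ?v" "eject_particle n (e - 1) h = ?u" by auto
    qed
    have u: "eject_particle a (e - 1) h = ?u"
      using a a1 by (auto simp: eject_particle_def fun_eq_iff)
    have uv: "?u(e := ?u e + 1) = ?v" "?v(e := ?v e - 1) = ?u"
    proof -
      have "?u x = ?v x" if "x \<noteq> e" for x
        using that le_a[of "x + 1"] by (auto simp: eject_particle_def)
      moreover have "?u e = int a" "?v e = int a + 1"
        using a a1 by (simp_all add: eject_particle_def)
      ultimately show "?u(e := ?u e + 1) = ?v" "?v(e := ?v e - 1) = ?u"
        by (auto simp: fun_eq_iff)
    qed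
    have lower: "hecke q e ?u = bernoulli_pmf q \<bind> (\<lambda>b. if b then return_pmf ?v else return_pmf ?u)"
      unfolding uv(1)[symmetric] using a a1 by (intro hecke_lower) (simp_all add: eject_particle_def)
    have upper: "hecke q e ?v = return_pmf ?u"
      using a a1 uv by (subst hecke_upper) (simp_all add: eject_particle_def)
    have "geometric_pmf (1 - q) \<bind> (\<lambda>n. hecke q e (eject_particle n e h)) = geometric_pmf (1 - q) \<bind> ?g"
    proof (rule bind_geometric_tail[OF q, where a = a])
      show "hecke q e (eject_particle n e h) = ?g n" if "n < a" for n using path that by blast
      show "hecke q e (eject_particle n e h) = return_pmf ?u" if "a < n" for n
        by (simp only: ev[OF that] upper)
      show "?g n = bernoulli_pmf q \<bind> (\<lambda>b. return_pmf (if b then ?u else ?v))" if "a < n" for n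
        using ev[OF that] by (intro bind_pmf_cong) auto
      show "(1 - q) * pmf (hecke q e ?u) i + q * pmf (return_pmf ?u) i =
         (1 - q) * pmf (?g a) i + q * pmf (bernoulli_pmf q \<bind> (\<lambda>b. return_pmf (if b then ?u else ?v))) i" for i
        using q by (simp add: lower u pmf_bind_bernoulli algebra_simps)
    qed
    then show ?thesis by (simp add: row_pmf_bind R)
  qed
qed

subsection \<open>Products of row operators\<close>

text \<open>The height function of the step configuration. Heights count the particles strictly to
  the left, and the first particle is at site 1, hence \<open>x - 1\<close>.\<close>

definition step_height :: "int \<Rightarrow> int" where
  "step_height x = max 0 (x - 1)"

lemma step_height_in_height_functions: "step_height \<in> height_functions"
  by (auto simp: height_functions_def step_height_def intro!: exI[of _ 1])

fun rows_pmf :: "real \<Rightarrow> int list \<Rightarrow> (int \<Rightarrow> int) pmf" where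
  "rows_pmf q [] = return_pmf step_height"
| "rows_pmf q (e # l) = rows_pmf q l \<bind> row_pmf q e"

lemma set_rows: "set_pmf (rows_pmf q l) \<subseteq> height_functions"
  by (induction l) (auto simp: row_pmf_def step_height_in_height_functions eject_particle_in_height_functions)

text \<open>The only corner of the step configuration is at 1, and \<open>R 0\<close> fixes this
  configuration, so \<open>T 1\<close> acts on it as \<open>R 1\<close>.\<close>

lemma hecke_step_height:
  assumes q: "0 < q" "q < 1"
  shows "hecke q s step_height = (if s = 1 then row_pmf q 1 step_height else return_pmf step_height)"
proof (cases "s = 1")
  case True
  have "eject_particle n 0 step_height = step_height" for n
    by (auto simp: eject_particle_def step_height_def fun_eq_iff)
  then have "row_pmf q 0 step_height = return_pmf step_height"
    by (simp add: row_pmf_def map_pmf_const)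
  then show ?thesis
    using hecke_row_next[OF q step_height_in_height_functions, of 0] True by (simp add: bind_return_pmf)
next
  case False
  then show ?thesis
    by (subst hecke_fixed) (auto simp: step_height_def)
qed

text \<open>The head of the list acts last, so \<open>T s\<close> meets it first. It is absorbed by
  the head if \<open>s = e\<close> or \<open>s = e + 1\<close>, and otherwise passes to the tail as
  \<open>T (s + 1)\<close> or \<open>T s\<close>; the induction therefore runs over all
  \<open>s\<close>. If it reaches the step configuration it becomes \<open>R 1\<close> or
  disappears.\<close>

lemma rows_bind_hecke:
  assumes q: "0 < q" "q < 1"
  shows "\<exists>w. rows_pmf q l \<bind> hecke q s = w \<bind> rows_pmf q"
proof (induction l arbitrary: s)
  case Nil
  show ?case
  proof (cases "s = 1")
    case True
    then show ?thesis
      by (intro exI[of _ "return_pmf [1]"]) (simp add: bind_return_pmf hecke_step_height[OF q])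
  next
    case False
    then show ?thesis
      by (intro exI[of _ "return_pmf []"]) (simp add: bind_return_pmf hecke_step_height[OF q])
  qed
next
  case (Cons e l)
  have assoc: "rows_pmf q (e # l) \<bind> hecke q s = rows_pmf q l \<bind> (\<lambda>h. row_pmf q e h \<bind> hecke q s)"
    by (simp add: bind_assoc_pmf)
  have commute: "\<exists>w. rows_pmf q (e # l) \<bind> hecke q s = w \<bind> rows_pmf q"
    if "\<And>h. h \<in> height_functions \<Longrightarrow> row_pmf q e h \<bind> hecke q s = hecke q s' h \<bind> row_pmf q e" for s'
  proof -
    obtain w where w: "rows_pmf q l \<bind> hecke q s' = w \<bind> rows_pmf q" using Cons.IH by blast
    have "rows_pmf q (e # l) \<bind> hecke q s = rows_pmf q l \<bind> (\<lambda>h. hecke q s' h \<bind> row_pmf q e)"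
      unfolding assoc using that set_rows by (intro bind_pmf_cong[OF refl]) auto
    also have "\<dots> = map_pmf ((#) e) w \<bind> rows_pmf q"
      by (simp add: bind_assoc_pmf[symmetric] w) (simp add: bind_assoc_pmf bind_map_pmf)
    finally show ?thesis by blast
  qed
  consider "s < e" | "s = e" | "s = e + 1" | "e + 1 < s" by linarith
  then show ?case
  proof cases
    case 1
    then show ?thesis by (intro commute[of "s + 1"] hecke_row_below[OF q])
  next
    case 2
    have "rows_pmf q (e # l) \<bind> hecke q s = rows_pmf q l \<bind> (\<lambda>h. bernoulli_pmf q \<bind> (\<lambda>b. row_pmf q (if b then e - 1 else e) h))"
      unfolding assoc unfolding 2 by (rule bind_pmf_cong[OF refl hecke_row_same[OF q subsetD[OF set_rows]]])
    also have "\<dots> = map_pmf (\<lambda>b. (if b then e - 1 else e) # l) (bernoulli_pmf q) \<bind> rows_pmf q"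
      by (simp add: bind_map_pmf bind_commute_pmf[of "bernoulli_pmf q"])
    finally show ?thesis by blast
  next
    case 3
    have "rows_pmf q (e # l) \<bind> hecke q s = rows_pmf q l \<bind> row_pmf q (e + 1)"
      unfolding assoc unfolding 3 by (rule bind_pmf_cong[OF refl hecke_row_next[OF q subsetD[OF set_rows]]])
    also have "\<dots> = return_pmf ((e + 1) # l) \<bind> rows_pmf q"
      by (simp add: bind_return_pmf)
    finally show ?thesis by blast
  next
    case 4
    then show ?thesis by (intro commute[of s] hecke_row_above)
  qed
qed

section \<open>Invariant measures and comparison with products of row operators\<close>

lemma detailed_balance_invariant:
  assumes "\<And>x y. pmf p x * pmf (K x) y = pmf p y * pmf (K y) x"
  shows "p \<bind> K = p"
proof (rule pmf_eqI)
  fix i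
  have "ennreal (pmf (p \<bind> K) i) = (\<integral>\<^sup>+x. ennreal (pmf p x * pmf (K x) i) \<partial>count_space UNIV)"
    by (simp add: ennreal_pmf_bind nn_integral_measure_pmf ennreal_mult)
  also have "\<dots> = (\<integral>\<^sup>+x. ennreal (pmf p i * pmf (K i) x) \<partial>count_space UNIV)"
    by (simp only: assms[of _ i])
  also have "\<dots> = ennreal (pmf p i)"
    by (simp add: ennreal_mult nn_integral_cmult nn_integral_pmf)
  finally show "pmf (p \<bind> K) i = pmf p i" by simp
qed

text \<open>Both mass functions have total mass 1, so there is no room for a strict
  inequality.\<close>

lemma pmf_eqI_le:
  assumes "\<And>x. pmf p x \<le> pmf p' x"
  shows "p = p'"
  using assms pmf_neq_exists_less[of p' p] by (metis not_le)

text \<open>\<open>R e\<close> is \<open>T e \<cdots> T (e - k + 1)\<close> up to the event, negligible for large \<open>k\<close>, that the height at \<open>e - k + 1\<close> is not \<open>0\<close>.\<close>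

lemma hecke_invariant_imp_row_invariant:
  assumes q: "0 < q" "q < 1" and p: "set_pmf p \<subseteq> height_functions"
    and inv: "\<And>s. p \<bind> hecke q s = p"
  shows "p \<bind> row_pmf q e = p"
proof (rule sym, rule pmf_eqI_le)
  fix i
  let ?A = "\<lambda>k. {h \<in> height_functions. h (e - int k + 1) \<noteq> 0}"
  \<comment> \<open>\<open>K\<close> is the composition of \<open>T (e - k + 1)\<close> up to
    \<open>T e\<close>, which turns \<open>R (e - k)\<close> into \<open>R e\<close> and preserves
    \<open>p\<close> by assumption.\<close>
  have "\<exists>K. (\<forall>h\<in>height_functions. row_pmf q e h = row_pmf q (e - int k) h \<bind> K) \<and> p \<bind> K = p" for k
  proof (induction k)
    case 0
    show ?case by (intro exI[of _ return_pmf]) (simp add: bind_return_pmf')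
  next
    case (Suc k)
    then obtain K where K: "\<And>h. h \<in> height_functions \<Longrightarrow> row_pmf q e h = row_pmf q (e - int k) h \<bind> K" "p \<bind> K = p"
      by blast
    have "row_pmf q e h = row_pmf q (e - int (Suc k)) h \<bind> (\<lambda>h. hecke q (e - int k) h \<bind> K)"
      if "h \<in> height_functions" for h
      using K(1)[OF that] hecke_row_next[OF q that, of "e - int (Suc k)"] by (simp add: bind_assoc_pmf[symmetric])
    moreover have "p \<bind> (\<lambda>h. hecke q (e - int k) h \<bind> K) = p"
      by (simp add: bind_assoc_pmf[symmetric] inv K(2))
    ultimately show ?case by blast
  qed
  then obtain K where K: "\<And>k h. h \<in> height_functions \<Longrightarrow> row_pmf q e h = row_pmf q (e - int k) h \<bind> K k"
    "\<And>k. p \<bind> K k = p" by metis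
  have row_id: "row_pmf q m h = return_pmf h" if h: "h \<in> height_functions" "h (m + 1) = 0" for h m
  proof -
    have "h x = 0" if "x \<le> m + 1" for x
      using height_functions_mono[OF h(1) that] height_functions_nonneg[OF h(1), of x] h(2) by simp
    then have "eject_particle n m h = h" for n by (simp add: eject_particle_def fun_eq_iff)
    then show ?thesis by (simp add: row_pmf_def map_pmf_const)
  qed
  \<comment> \<open>Outside \<open>?A k\<close> the operator \<open>R (e - k)\<close> fixes
    \<open>h\<close>, so \<open>K k\<close> and \<open>R e\<close> have the same law from
    \<open>h\<close>; on \<open>?A k\<close> the mass is bounded by 1.\<close>
  have bound: "pmf p i \<le> pmf (p \<bind> row_pmf q e) i + measure_pmf.prob p (?A k)" for k
  proof -
    have int: "integrable p (\<lambda>h. pmf (M h) i)" "integrable p (indicator (?A k) :: _ \<Rightarrow> real)" for M :: "_ \<Rightarrow> (int \<Rightarrow> int) pmf"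
      by (auto intro!: measure_pmf.integrable_const_bound[where B = 1] simp: pmf_le_1)
    have "pmf p i = (\<integral>h. pmf (K k h) i \<partial>p)"
      using K(2)[of k] by (simp flip: pmf_bind)
    also have "\<dots> \<le> (\<integral>h. pmf (row_pmf q e h) i + indicator (?A k) h \<partial>p)"
    proof (rule integral_mono_AE)
      show "integrable p (\<lambda>h. pmf (K k h) i)" "integrable p (\<lambda>h. pmf (row_pmf q e h) i + indicator (?A k) h)"
        using int by auto
      show "AE h in p. pmf (K k h) i \<le> pmf (row_pmf q e h) i + indicator (?A k) h"
      proof (rule AE_pmfI)
        fix h assume "h \<in> set_pmf p"
        then have h: "h \<in> height_functions" using p by auto
        show "pmf (K k h) i \<le> pmf (row_pmf q e h) i + indicator (?A k) h"
        proof (cases "h (e - int k + 1) = 0")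
          case True
          then show ?thesis using K(1)[OF h, of k] row_id[OF h] by (simp add: bind_return_pmf)
        next
          case False
          then show ?thesis using h by (simp add: pmf_le_1 add_increasing)
        qed
      qed
    qed
    also have "\<dots> = pmf (p \<bind> row_pmf q e) i + measure_pmf.prob p (?A k)"
      by (subst Bochner_Integration.integral_add) (auto simp: pmf_bind int)
    finally show ?thesis .
  qed
  have lim: "(\<lambda>k. pmf (p \<bind> row_pmf q e) i + measure_pmf.prob p (?A k)) \<longlonglongrightarrow> pmf (p \<bind> row_pmf q e) i + 0"
  proof (intro tendsto_intros)
    have "(\<lambda>k. measure_pmf.prob p (?A k)) \<longlonglongrightarrow> measure_pmf.prob p (\<Inter>k. ?A k)"
    proof (rule measure_pmf.finite_Lim_measure_decseq)
      show "decseq ?A"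
      proof (rule decseq_SucI, rule subsetI)
        fix k h assume h: "h \<in> ?A (Suc k)"
        then have "h (e - int (Suc k) + 1) \<le> h (e - int k + 1)" "0 \<le> h (e - int (Suc k) + 1)"
          using height_functions_mono[of h "e - int (Suc k) + 1" "e - int k + 1"] height_functions_nonneg[of h]
          by simp_all
        then show "h \<in> ?A k" using h by auto
      qed
    qed simp
    also have "(\<Inter>k. ?A k) = {}"
    proof -
      have "\<exists>k. h (e - int k + 1) = 0" if h: "h \<in> height_functions" for h
      proof -
        obtain m where "\<forall>x\<le>m. h x = 0" using h by (auto simp: height_functions_def)
        then show ?thesis by (intro exI[of _ "nat (e + 1 - m)"]) auto
      qed
      then show ?thesis by auto
    qed
    finally show "(\<lambda>k. measure_pmf.prob p (?A k)) \<longlonglongrightarrow> 0" by simp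
  qed
  show "pmf p i \<le> pmf (p \<bind> row_pmf q e) i"
    using LIMSEQ_le_const[OF lim, of "pmf p i"] bound by auto
qed

text \<open>Start with the step configuration below a sample of \<open>p\<close>. Each row operator
  is monotone, so it keeps the order, and it preserves \<open>p\<close>.\<close>

lemma rows_le_invariant:
  assumes q: "0 < q" "q < 1" and p: "set_pmf p \<subseteq> {h \<in> height_functions. step_height \<le> h}"
    and inv: "\<And>s. p \<bind> hecke q s = p"
  shows "rel_pmf (\<le>) (rows_pmf q l) p"
proof (induction l)
  case Nil
  then show ?case using p by (auto simp: rel_pmf_return_pmf1)
next
  case (Cons e l)
  have "rel_pmf (\<le>) (rows_pmf q l \<bind> row_pmf q e) (p \<bind> row_pmf q e)"
    using Cons.IH
  proof (rule rel_pmf_bindI)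
    fix h k :: "int \<Rightarrow> int" assume "h \<le> k"
    then show "rel_pmf (\<le>) (row_pmf q e h) (row_pmf q e k)"
      unfolding row_pmf_def pmf.rel_map by (intro rel_pmf_reflI eject_particle_mono)
  qed
  moreover have "p \<bind> row_pmf q e = p"
    using p by (intro hecke_invariant_imp_row_invariant[OF q _ inv]) auto
  ultimately show ?case by simp
qed

section \<open>The six-vertex update as a mixture of Hecke updates\<close>

definition update :: "real \<Rightarrow> real \<Rightarrow> int \<Rightarrow> (int \<Rightarrow> int) \<Rightarrow> (int \<Rightarrow> int) pmf" where
  "update b\<^sub>1 b\<^sub>2 s h = map_pmf (\<lambda>c. flip s c h) (pair_pmf (bernoulli_pmf b\<^sub>1) (bernoulli_pmf b\<^sub>2))"

text \<open>Performing \<open>T s\<close> with probability \<open>b\<^sub>2\<close> raises a lower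
  corner with probability \<open>b\<^sub>2 * (b\<^sub>1 / b\<^sub>2) = b\<^sub>1\<close> and lowers
  an upper one with probability \<open>b\<^sub>2\<close>.\<close>

lemma update_eq_hecke:
  assumes b: "0 < b\<^sub>1" "b\<^sub>1 < b\<^sub>2" "b\<^sub>2 < 1" and h: "h \<in> height_functions"
  shows "update b\<^sub>1 b\<^sub>2 s h = bernoulli_pmf b\<^sub>2 \<bind> (\<lambda>b. if b then hecke (b\<^sub>1 / b\<^sub>2) s h else return_pmf h)"
proof -
  have expand: "pmf (update b\<^sub>1 b\<^sub>2 s h) i = b\<^sub>1 * (b\<^sub>2 * pmf (return_pmf (flip s (True, True) h)) i
      + (1 - b\<^sub>2) * pmf (return_pmf (flip s (True, False) h)) i)
      + (1 - b\<^sub>1) * (b\<^sub>2 * pmf (return_pmf (flip s (False, True) h)) i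
      + (1 - b\<^sub>2) * pmf (return_pmf (flip s (False, False) h)) i)" for i
    using b by (simp add: update_def map_pmf_def pair_pmf_def bind_assoc_pmf bind_return_pmf pmf_bind_bernoulli del: pmf_return)
  have q: "0 \<le> b\<^sub>1 / b\<^sub>2" "b\<^sub>1 / b\<^sub>2 \<le> 1" using b by auto
  have expand': "pmf (bernoulli_pmf b\<^sub>2 \<bind> (\<lambda>b. if b then hecke (b\<^sub>1 / b\<^sub>2) s h else return_pmf h)) i =
      b\<^sub>2 * (b\<^sub>1 / b\<^sub>2 * pmf (return_pmf (flip s (True, True) h)) i
      + (1 - b\<^sub>1 / b\<^sub>2) * pmf (return_pmf (flip s (False, True) h)) i) + (1 - b\<^sub>2) * pmf (return_pmf h) i" for i
    using b q by (simp add: hecke_def map_pmf_def pmf_bind_bernoulli del: pmf_return)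
  show ?thesis
  proof (rule pmf_eqI)
    fix i
    have "flip s (False, False) h = h"
      using height_functionsD[OF h, of s] by (auto simp: flip_def)
    moreover have "flip s (True, True) h = flip s (True, False) h \<and> flip s (False, True) h = flip s (False, False) h \<or>
        flip s (True, True) h = flip s (False, True) h \<and> flip s (True, False) h = flip s (False, False) h"
      by (auto simp: flip_def)
    ultimately show "pmf (update b\<^sub>1 b\<^sub>2 s h) i =
        pmf (bernoulli_pmf b\<^sub>2 \<bind> (\<lambda>b. if b then hecke (b\<^sub>1 / b\<^sub>2) s h else return_pmf h)) i"
      unfolding expand expand' using b by (auto simp: field_simps simp del: pmf_return)
  qed
qed

text \<open>Mixtures of row products from the step configuration form a class closed under vertex
  updates. Membership in this class is the invariant carried along the dynamics.\<close>

lemma rows_bind_update: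
  assumes b: "0 < b\<^sub>1" "b\<^sub>1 < b\<^sub>2" "b\<^sub>2 < 1"
  shows "\<exists>w'. w \<bind> rows_pmf (b\<^sub>1 / b\<^sub>2) \<bind> update b\<^sub>1 b\<^sub>2 s = w' \<bind> rows_pmf (b\<^sub>1 / b\<^sub>2)"
proof -
  let ?q = "b\<^sub>1 / b\<^sub>2"
  have q: "0 < ?q" "?q < 1" using b by auto
  obtain f where f: "\<And>l. rows_pmf ?q l \<bind> hecke ?q s = f l \<bind> rows_pmf ?q"
    using choice[of "\<lambda>l w. rows_pmf ?q l \<bind> hecke ?q s = w \<bind> rows_pmf ?q"] rows_bind_hecke[OF q] by auto
  have "w \<bind> rows_pmf ?q \<bind> update b\<^sub>1 b\<^sub>2 s = w \<bind> (\<lambda>l. rows_pmf ?q l \<bind>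
      (\<lambda>h. bernoulli_pmf b\<^sub>2 \<bind> (\<lambda>b. if b then hecke ?q s h else return_pmf h)))"
    unfolding bind_assoc_pmf by (intro bind_pmf_cong[OF refl] update_eq_hecke[OF b] subsetD[OF set_rows])
  also have "\<dots> = w \<bind> (\<lambda>l. bernoulli_pmf b\<^sub>2 \<bind>
      (\<lambda>b. rows_pmf ?q l \<bind> (\<lambda>h. if b then hecke ?q s h else return_pmf h)))"
    by (rule bind_pmf_cong[OF refl bind_commute_pmf])
  also have "\<dots> = w \<bind> (\<lambda>l. bernoulli_pmf b\<^sub>2 \<bind> (\<lambda>b. (if b then f l else return_pmf l) \<bind> rows_pmf ?q))"
    by (intro bind_pmf_cong) (auto simp: f bind_return_pmf bind_return_pmf')
  also have "\<dots> = (w \<bind> (\<lambda>l. bernoulli_pmf b\<^sub>2 \<bind> (\<lambda>b. if b then f l else return_pmf l))) \<bind> rows_pmf ?q"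
    by (simp add: bind_assoc_pmf)
  finally show ?thesis by blast
qed

subsection \<open>Configurations and their height functions\<close>

lemma space_config_space: "space config_space = UNIV"
  by (auto simp: config_space_def space_PiM)

lemma singleton_in_config_space: "{\<eta>} \<in> sets config_space"
proof -
  have "{\<eta>} = (\<Inter>x. {\<zeta> \<in> space config_space. \<zeta> x = \<eta> x})"
    by (auto simp: space_config_space fun_eq_iff)
  also have "\<dots> \<in> sets config_space"
    unfolding config_space_def by (intro sets.countable_INT) (auto intro: sets_Collect_single')
  finally show ?thesis .
qed

lemma infsum_of_bool_ennreal:
  "(\<Sum>\<^sub>\<infinity>x\<in>A. of_bool (P x) :: ennreal) = (if finite {x \<in> A. P x} then of_nat (card {x \<in> A. P x}) else \<infinity>)"
proof -
  have "(\<Sum>\<^sub>\<infinity>x\<in>A. of_bool (P x) :: ennreal) = (\<Sum>\<^sub>\<infinity>x\<in>{x \<in> A. P x}. 1)"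
    by (rule infsum_cong_neutral) auto
  also have "\<dots> = (if finite {x \<in> A. P x} then of_nat (card {x \<in> A. P x}) else \<infinity>)"
    using infsum_superconst_infinite_ennreal[of "{x \<in> A. P x}" 1 "\<lambda>_. 1"] by auto
  finally show ?thesis .
qed

lemma configs_A_iff:
  "\<eta> \<in> configs_A \<longleftrightarrow> finite {x. x \<le> 0 \<and> \<eta> x} \<and> finite {x. 0 < x \<and> \<not> \<eta> x} \<and>
     card {x. x \<le> 0 \<and> \<eta> x} = card {x. 0 < x \<and> \<not> \<eta> x}"
proof -
  have "(\<Sum>\<^sub>\<infinity>x\<in>{1..}. 1 - of_bool (\<eta> x) :: ennreal) = (\<Sum>\<^sub>\<infinity>x\<in>{1..}. of_bool (\<not> \<eta> x))"
    by (rule infsum_cong) auto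
  moreover have "{x \<in> {..0}. \<eta> x} = {x. x \<le> 0 \<and> \<eta> x}" "{x \<in> {1..}. \<not> \<eta> x} = {x. 0 < x \<and> \<not> \<eta> x}"
    by auto
  ultimately show ?thesis
    by (auto simp: configs_A_def infsum_of_bool_ennreal less_top[symmetric] of_nat_eq_iff)
qed

text \<open>A configuration in \<open>configs_A\<close> is determined by two finite sets, its
  particles at sites up to 0 and its holes at positive sites. Countability allows measures on
  \<open>configs_A\<close> to be treated as mass functions.\<close>

lemma countable_configs_A: "countable configs_A"
proof -
  let ?f = "\<lambda>(F, G) x. if x \<le> 0 then x \<in> F else x \<notin> G"
  have "\<eta> \<in> ?f ` ({F. finite F} \<times> {G. finite G})" if "\<eta> \<in> configs_A" for \<eta>
    using that by (intro image_eqI[of _ _ "({x. x \<le> 0 \<and> \<eta> x}, {x. 0 < x \<and> \<not> \<eta> x})"]) (auto simp: configs_A_iff)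
  moreover have "countable (?f ` ({F :: int set. finite F} \<times> {G :: int set. finite G}))"
    by (intro countable_image countable_SIGMA countable_Collect_finite)
  ultimately show ?thesis by (meson countable_subset subsetI)
qed

lemma config_set_in_sets: "B \<subseteq> configs_A \<Longrightarrow> B \<in> sets config_space"
  using countable_subset[OF _ countable_configs_A]
  by (intro sets.countable[OF singleton_in_config_space]) auto

definition config_of :: "(int \<Rightarrow> int) \<Rightarrow> config" where
  "config_of h x \<longleftrightarrow> h (x + 1) \<noteq> h x"

text \<open>The image of \<open>configs_A\<close> under \<open>height\<close>; that particles at
  sites up to 0 and holes at positive sites are equally many becomes the normalisation
  \<open>x - 1\<close> far to the right.\<close>

definition heights_A :: "(int \<Rightarrow> int) set" where
  "heights_A = {h \<in> height_functions. \<exists>m. \<forall>x\<ge>m. h x = x - 1}"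

lemma is_height_card:
  assumes fin: "finite {x. x \<le> 0 \<and> \<eta> x}"
  shows "is_height \<eta> (\<lambda>x. int (card {y. y < x \<and> \<eta> y}))"
  unfolding is_height_def
proof (intro conjI allI)
  have fin': "finite {y. y < x \<and> \<eta> y}" for x
    by (rule finite_subset[of _ "{x. x \<le> 0 \<and> \<eta> x} \<union> {0..x}"]) (use fin in auto)
  fix x :: int
  show "int (card {y. y < x + 1 \<and> \<eta> y}) - int (card {y. y < x \<and> \<eta> y}) = of_bool (\<eta> x)"
  proof (cases "\<eta> x")
    case True
    then have "{y. y < x + 1 \<and> \<eta> y} = insert x {y. y < x \<and> \<eta> y}" by auto
    then show ?thesis using True fin'[of x] by simp
  next
    case False
    then have "{y. y < x + 1 \<and> \<eta> y} = {y. y < x \<and> \<eta> y}" by (auto simp: order_le_less)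
    then show ?thesis using False by simp
  qed
next
  obtain b where b: "\<And>x. x \<in> {x. x \<le> 0 \<and> \<eta> x} \<Longrightarrow> b \<le> x"
    using bdd_below_finite[OF fin] by (meson bdd_below.E)
  have "{y. y < x \<and> \<eta> y} = {}" if "x \<le> min b 0" for x
  proof (rule equals0I)
    fix y assume "y \<in> {y. y < x \<and> \<eta> y}"
    then show False using b[of y] that by auto
  qed
  then have "card {y. y < x \<and> \<eta> y} = 0" if "x \<le> min b 0" for x
    using that by (metis card.empty)
  then show "((\<lambda>x. int (card {y. y < x \<and> \<eta> y})) \<longlongrightarrow> 0) at_bot"
    by (intro tendsto_eventually) (auto simp: eventually_at_bot_linorder intro!: exI[of _ "min b 0"])
qed

lemma height_eqI:
  assumes "finite {x. x \<le> 0 \<and> \<eta> x}" "is_height \<eta> h"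
  shows "height \<eta> = h"
  unfolding height_def using is_height_ex1[OF assms(1)] assms(2) by (metis the1_equality)

lemma height_eq_card:
  assumes "finite {x. x \<le> 0 \<and> \<eta> x}"
  shows "height \<eta> x = int (card {y. y < x \<and> \<eta> y})"
  using height_eqI[OF assms is_height_card[OF assms]] by simp

text \<open>To the right of 0 holes are counted instead of particles, so that the balance condition
  of \<open>configs_A\<close> becomes the cancellation of the last two terms.\<close>

lemma height_right:
  assumes fin: "finite {x. x \<le> 0 \<and> \<eta> x}" and x: "1 \<le> x"
  shows "height \<eta> x = x - 1 + int (card {y. y \<le> 0 \<and> \<eta> y}) - int (card {y. 0 < y \<and> y < x \<and> \<not> \<eta> y})"
proof -
  have "finite {y. 0 < y \<and> y < x \<and> P y}" for P
    by (rule finite_subset[of _ "{0..x}"]) auto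
  then have "card {0<..<x} = card {y. 0 < y \<and> y < x \<and> \<eta> y} + card {y. 0 < y \<and> y < x \<and> \<not> \<eta> y}"
    "card {y. y < x \<and> \<eta> y} = card {y. y \<le> 0 \<and> \<eta> y} + card {y. 0 < y \<and> y < x \<and> \<eta> y}"
    using fin x by (subst card_Un_disjoint[symmetric]; force intro!: arg_cong[where f = card])+
  then show ?thesis
    using x by (simp add: height_eq_card[OF fin])
qed

lemma is_height_in_height_functions:
  assumes "is_height \<eta> h"
  shows "h \<in> height_functions"
proof -
  have "h (x + 1) = h x \<or> h (x + 1) = h x + 1" for x
    using assms spec[of "\<lambda>x. h (x + 1) - h x = of_bool (\<eta> x)" x]
    by (cases "\<eta> x") (auto simp: is_height_def algebra_simps)
  moreover have "\<exists>m. \<forall>x\<le>m. h x = 0"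
    using assms by (auto simp: is_height_def tendsto_discrete eventually_at_bot_linorder)
  ultimately show ?thesis by (auto simp: height_functions_def)
qed

text \<open>In \<open>height_right\<close> the two counts cancel once \<open>x\<close> is past the
  last hole, and before that the subtracted one is at most the added one. The latter makes the step
  configuration the lowest in \<open>configs_A\<close>.\<close>

lemma
  assumes \<eta>: "\<eta> \<in> configs_A"
  shows height_in_heights_A: "height \<eta> \<in> heights_A"
    and config_of_height: "config_of (height \<eta>) = \<eta>"
    and step_height_le_height: "step_height \<le> height \<eta>"
proof -
  have fin: "finite {x. x \<le> 0 \<and> \<eta> x}" "finite {x. 0 < x \<and> \<not> \<eta> x}"
    and card: "card {x. x \<le> 0 \<and> \<eta> x} = card {x. 0 < x \<and> \<not> \<eta> x}"
    using \<eta> by (auto simp: configs_A_iff)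
  have ih: "is_height \<eta> (height \<eta>)"
    unfolding height_def using is_height_ex1[OF fin(1)] by (rule theI')
  have h: "height \<eta> \<in> height_functions" by (rule is_height_in_height_functions[OF ih])
  show "config_of (height \<eta>) = \<eta>"
  proof
    fix x
    have "height \<eta> (x + 1) - height \<eta> x = of_bool (\<eta> x)" using ih by (auto simp: is_height_def)
    then show "config_of (height \<eta>) x = \<eta> x" by (cases "\<eta> x") (auto simp: config_of_def)
  qed
  obtain b where b: "\<And>x. x \<in> {x. 0 < x \<and> \<not> \<eta> x} \<Longrightarrow> x \<le> b"
    using bdd_above_finite[OF fin(2)] by (meson bdd_above.E)
  have "height \<eta> x = x - 1" if "max 1 (b + 1) \<le> x" for x
  proof -
    have "{y. 0 < y \<and> y < x \<and> \<not> \<eta> y} = {y. 0 < y \<and> \<not> \<eta> y}" using b that by force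
    then show ?thesis using height_right[OF fin(1), of x] that card by simp
  qed
  then show "height \<eta> \<in> heights_A" using h unfolding heights_A_def by blast
  show "step_height \<le> height \<eta>"
  proof (rule le_funI)
    fix x
    have "card {y. 0 < y \<and> y < x \<and> \<not> \<eta> y} \<le> card {y. 0 < y \<and> \<not> \<eta> y}"
      by (rule card_mono[OF fin(2)]) auto
    then have "x - 1 \<le> height \<eta> x" if "1 \<le> x"
      using height_right[OF fin(1) that] card by simp
    then show "step_height x \<le> height \<eta> x"
      using height_functions_nonneg[OF h, of x] by (cases "1 \<le> x") (auto simp: step_height_def)
  qed
qed

lemma
  assumes h: "h \<in> heights_A"
  shows height_config_of: "height (config_of h) = h"
    and config_of_in_configs_A: "config_of h \<in> configs_A"
proof -
  let ?\<eta> = "config_of h"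
  obtain m M where hf: "h \<in> height_functions" and m: "\<And>x. x \<le> m \<Longrightarrow> h x = 0" and M: "\<And>x. M \<le> x \<Longrightarrow> h x = x - 1"
    using h by (auto simp: heights_A_def height_functions_def)
  have fin: "finite {x. x \<le> 0 \<and> ?\<eta> x}"
  proof (rule finite_subset)
    show "{x. x \<le> 0 \<and> ?\<eta> x} \<subseteq> {m..0}"
    proof (rule ccontr)
      assume "\<not> {x. x \<le> 0 \<and> ?\<eta> x} \<subseteq> {m..0}"
      then obtain x where "x < m" "?\<eta> x" by force
      then show False using m[of x] m[of "x + 1"] by (simp add: config_of_def)
    qed
  qed simp
  have fin2: "finite {x. 0 < x \<and> \<not> ?\<eta> x}"
  proof (rule finite_subset)
    show "{x. 0 < x \<and> \<not> ?\<eta> x} \<subseteq> {0..M}"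
    proof (rule ccontr)
      assume "\<not> {x. 0 < x \<and> \<not> ?\<eta> x} \<subseteq> {0..M}"
      then obtain x where "M < x" "\<not> ?\<eta> x" by force
      then show False using M[of x] M[of "x + 1"] by (simp add: config_of_def)
    qed
  qed simp
  have "is_height ?\<eta> h"
    unfolding is_height_def
  proof (intro conjI allI)
    show "(h \<longlongrightarrow> 0) at_bot"
      by (rule tendsto_eventually) (auto simp: eventually_at_bot_linorder intro!: exI[of _ m] m)
    show "h (x + 1) - h x = of_bool (?\<eta> x)" for x
      using height_functionsD(1)[OF hf, of x] by (auto simp: config_of_def)
  qed
  then show eq: "height ?\<eta> = h" by (rule height_eqI[OF fin])
  \<comment> \<open>A positive site beyond all holes; comparing \<open>height_right\<close> there
    with \<open>x - 1\<close> gives the balance of particles and holes.\<close>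
  define x where "x = max (M + 1) 1"
  have "{y. 0 < y \<and> y < x \<and> \<not> ?\<eta> y} = {y. 0 < y \<and> \<not> ?\<eta> y}"
  proof -
    have "?\<eta> y" if "M \<le> y" for y using that M[of y] M[of "y + 1"] by (simp add: config_of_def)
    then have "y < x" if "\<not> ?\<eta> y" for y
      using that by (force simp: x_def not_le[symmetric])
    then show ?thesis by auto
  qed
  then have "card {x. x \<le> 0 \<and> ?\<eta> x} = card {x. 0 < x \<and> \<not> ?\<eta> x}"
    using height_right[OF fin, of x] M[of x] by (simp add: eq x_def)
  then show "config_of h \<in> configs_A" using fin fin2 by (simp add: configs_A_iff)
qed

section \<open>Measures on \<open>configs_A\<close> as probability mass functions\<close>

text \<open>A measure carried by a countable set of measurable points is determined by its atoms.
  The push-forward under the identity only replaces the full power set by the product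
  sigma-algebra.\<close>

lemma config_measure_eq_pmf:
  assumes "prob_on_A \<mu>"
  obtains p where "set_pmf p \<subseteq> configs_A" "\<mu> = distr (measure_pmf p) config_space (\<lambda>\<eta>. \<eta>)"
    "\<And>\<eta>. pmf p \<eta> = measure \<mu> {\<eta>}"
proof -
  interpret prob_space \<mu> using assms by (simp add: prob_on_A_def)
  have sets[measurable_cong]: "sets \<mu> = sets config_space" using assms by (simp add: prob_on_A_def)
  have sp: "space \<mu> = UNIV" using sets_eq_imp_space_eq[OF sets] by (simp add: space_config_space)
  have single: "{\<eta>} \<in> sets \<mu>" for \<eta> by (simp add: sets singleton_in_config_space)
  have A: "AE \<eta> in \<mu>. \<eta> \<in> configs_A" using assms by (simp add: prob_on_A_def)
  have null: "emeasure \<mu> {\<eta>} = 0" if "\<eta> \<notin> configs_A" for \<eta>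
  proof -
    have "emeasure \<mu> {\<eta>} = emeasure \<mu> {}"
      using A single that by (intro emeasure_eq_AE) auto
    then show ?thesis by simp
  qed
  have em: "emeasure \<mu> B = (\<integral>\<^sup>+\<eta>. ennreal (measure \<mu> {\<eta>}) * indicator B \<eta> \<partial>count_space UNIV)"
    if B: "B \<in> sets \<mu>" for B
  proof -
    have "emeasure \<mu> B = emeasure \<mu> (B \<inter> configs_A)"
      using A B sets config_set_in_sets[of configs_A] by (intro emeasure_eq_AE) auto
    also have "\<dots> = (\<integral>\<^sup>+\<eta>. emeasure \<mu> {\<eta>} \<partial>count_space (B \<inter> configs_A))"
      by (intro emeasure_countable_singleton single countable_Int2 countable_configs_A)
    also have "\<dots> = (\<integral>\<^sup>+\<eta>. emeasure \<mu> {\<eta>} * indicator (B \<inter> configs_A) \<eta> \<partial>count_space UNIV)"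
      by (rule nn_integral_count_space_indicator) simp
    also have "\<dots> = (\<integral>\<^sup>+\<eta>. ennreal (measure \<mu> {\<eta>}) * indicator B \<eta> \<partial>count_space UNIV)"
    proof (rule nn_integral_cong)
      fix \<eta>
      show "emeasure \<mu> {\<eta>} * indicator (B \<inter> configs_A) \<eta> = ennreal (measure \<mu> {\<eta>}) * indicator B \<eta>"
        using null[of \<eta>] by (auto simp: emeasure_eq_measure indicator_def)
    qed
    finally show ?thesis .
  qed
  define p where "p = embed_pmf (\<lambda>\<eta>. measure \<mu> {\<eta>})"
  have p: "pmf p \<eta> = measure \<mu> {\<eta>}" for \<eta>
    unfolding p_def using em[of UNIV] emeasure_space_1 sp sets.top[of \<mu>]
    by (intro pmf_embed_pmf) simp_all
  show thesis
  proof
    show "set_pmf p \<subseteq> configs_A"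
    proof
      fix \<eta> assume "\<eta> \<in> set_pmf p"
      then have "measure \<mu> {\<eta>} \<noteq> 0" by (simp add: set_pmf_iff p)
      then show "\<eta> \<in> configs_A" using null[of \<eta>] by (auto simp: emeasure_eq_measure)
    qed
    show "\<mu> = distr (measure_pmf p) config_space (\<lambda>\<eta>. \<eta>)"
    proof (rule measure_eqI)
      fix B assume B: "B \<in> sets \<mu>"
      have "emeasure (distr (measure_pmf p) config_space (\<lambda>\<eta>. \<eta>)) B = (\<integral>\<^sup>+\<eta>. indicator B \<eta> \<partial>measure_pmf p)"
        using B by (simp add: emeasure_distr sets space_config_space)
      also have "\<dots> = emeasure \<mu> B"
        unfolding em[OF B] nn_integral_measure_pmf p ..
      finally show "emeasure \<mu> B = emeasure (distr (measure_pmf p) config_space (\<lambda>\<eta>. \<eta>)) B" ..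
    qed (simp add: sets)
  qed (rule p)
qed

subsection \<open>Reversibility of the blocking measure\<close>

definition occupancy :: "real \<Rightarrow> int \<Rightarrow> real" where
  "occupancy q x = q powi (- x) / (1 + q powi (- x))"

lemma occupancy_bounds:
  assumes "0 < q"
  shows "0 < occupancy q x" "occupancy q x < 1" "1 - occupancy q x = 1 / (1 + q powi (- x))"
proof -
  define r where "r = q powi (- x)"
  have "0 < r" using assms by (simp add: r_def)
  then show "0 < occupancy q x" "occupancy q x < 1" "1 - occupancy q x = 1 / (1 + q powi (- x))"
    unfolding occupancy_def r_def[symmetric] by (simp_all add: field_simps)
qed

lemma sets_product_blocking: "sets (product_blocking q) = sets config_space"
  unfolding product_blocking_def config_space_def by (intro sets_PiM_cong) simp_all

text \<open>The cylinders fixing the sites in \<open>{- int n..int n}\<close> decrease to the single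
  configuration \<open>\<eta>\<close>.\<close>

lemma product_blocking_singleton:
  "(\<lambda>n. \<Prod>x\<in>{- int n..int n}. pmf (bernoulli_pmf (occupancy q x)) (\<eta> x)) \<longlonglongrightarrow> measure (product_blocking q) {\<eta>}"
proof -
  interpret product_prob_space "\<lambda>x. measure_pmf (bernoulli_pmf (occupancy q x))" "UNIV :: int set"
    by (intro product_prob_spaceI measure_pmf.prob_space_axioms)
  have M: "product_blocking q = PiM UNIV (\<lambda>x. measure_pmf (bernoulli_pmf (occupancy q x)))"
    by (simp add: product_blocking_def occupancy_def)
  let ?C = "\<lambda>n. {\<zeta> \<in> space (product_blocking q). \<forall>x\<in>{- int n..int n}. \<zeta> x \<in> {\<eta> x}}"
  have "emeasure (product_blocking q) (?C n) =
      (\<Prod>x\<in>{- int n..int n}. emeasure (measure_pmf (bernoulli_pmf (occupancy q x))) {\<eta> x})" for n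
    unfolding M by (rule emeasure_PiM_Collect) auto
  then have C: "measure (product_blocking q) (?C n) = (\<Prod>x\<in>{- int n..int n}. pmf (bernoulli_pmf (occupancy q x)) (\<eta> x))" for n
    by (simp add: measure_def emeasure_pmf_single prod_ennreal prod_nonneg)
  have "(\<lambda>n. measure (product_blocking q) (?C n)) \<longlonglongrightarrow> measure (product_blocking q) (\<Inter>n. ?C n)"
    unfolding M
  proof (rule finite_Lim_measure_decseq)
    show "range (\<lambda>n. {\<zeta> \<in> space (PiM UNIV (\<lambda>x. measure_pmf (bernoulli_pmf (occupancy q x)))). \<forall>x\<in>{- int n..int n}. \<zeta> x \<in> {\<eta> x}})
        \<subseteq> sets (PiM UNIV (\<lambda>x. measure_pmf (bernoulli_pmf (occupancy q x))))"
      by (intro image_subsetI sets.sets_Collect_finite_All) (auto intro!: sets_Collect_single')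
    show "decseq (\<lambda>n. {\<zeta> \<in> space (PiM UNIV (\<lambda>x. measure_pmf (bernoulli_pmf (occupancy q x)))). \<forall>x\<in>{- int n..int n}. \<zeta> x \<in> {\<eta> x}})"
    proof (rule decseq_SucI, rule subsetI)
      fix n :: nat and \<zeta> :: config
      assume "\<zeta> \<in> {\<zeta> \<in> space (PiM UNIV (\<lambda>x. measure_pmf (bernoulli_pmf (occupancy q x)))). \<forall>x\<in>{- int (Suc n)..int (Suc n)}. \<zeta> x \<in> {\<eta> x}}"
      then show "\<zeta> \<in> {\<zeta> \<in> space (PiM UNIV (\<lambda>x. measure_pmf (bernoulli_pmf (occupancy q x)))). \<forall>x\<in>{- int n..int n}. \<zeta> x \<in> {\<eta> x}}"
        by simp
    qed
  qed
  also have "(\<Inter>n. ?C n) = {\<eta>}"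
  proof -
    have "\<exists>n. x \<in> {- int n..int n}" for x by (intro exI[of _ "nat \<bar>x\<bar>"]) auto
    then have "\<zeta> = \<eta>" if "\<zeta> \<in> (\<Inter>n. ?C n)" for \<zeta> using that by (intro ext) fastforce
    moreover have "\<eta> \<in> (\<Inter>n. ?C n)" by (simp add: M space_PiM)
    ultimately show ?thesis by blast
  qed
  finally show ?thesis by (simp only: C)
qed

text \<open>The odds of occupation at \<open>s - 1\<close> are \<open>q\<close> times those at
  \<open>s\<close>, and all other factors agree. This is the source of detailed balance.\<close>

lemma product_blocking_swap:
  assumes q: "0 < q" and \<eta>: "\<not> \<eta> (s - 1)" "\<eta> s"
  shows "measure (product_blocking q) {\<eta>(s - 1 := True, s := False)} = q * measure (product_blocking q) {\<eta>}"
proof (rule LIMSEQ_unique[OF product_blocking_singleton])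
  let ?\<eta>' = "\<eta>(s - 1 := True, s := False)" and ?p = "\<lambda>\<eta> x. pmf (bernoulli_pmf (occupancy q x)) (\<eta> x)"
  have eq: "(\<Prod>x\<in>{- int n..int n}. ?p ?\<eta>' x) = q * (\<Prod>x\<in>{- int n..int n}. ?p \<eta> x)"
    \<comment> \<open>The window then contains both \<open>s - 1\<close> and
      \<open>s\<close>.\<close>
    if n: "\<bar>s\<bar> + 1 \<le> int n" for n
  proof -
    have split: "{- int n..int n} = insert s (insert (s - 1) ({- int n..int n} - {s - 1, s}))"
      using n by auto
    have rest: "(\<Prod>x\<in>{- int n..int n} - {s - 1, s}. ?p ?\<eta>' x) = (\<Prod>x\<in>{- int n..int n} - {s - 1, s}. ?p \<eta> x)"
      by (rule prod.cong) auto
    have "q powi (- (s - 1)) = q * q powi (- s)"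
      using q power_int_add[of q 1 "- s"] by (simp add: algebra_simps)
    then have odds: "occupancy q (s - 1) * (1 - occupancy q s) = q * ((1 - occupancy q (s - 1)) * occupancy q s)"
      unfolding occupancy_bounds(3)[OF q] by (simp add: occupancy_def)
    show ?thesis
      by (subst (1 2) split)
         (use \<eta> q occupancy_bounds[OF q] odds in \<open>simp add: rest less_imp_le mult.assoc[symmetric]\<close>)
  qed
  have "(\<lambda>n. q * (\<Prod>x\<in>{- int n..int n}. ?p \<eta> x)) \<longlonglongrightarrow> q * measure (product_blocking q) {\<eta>}"
    by (intro tendsto_intros product_blocking_singleton)
  then show "(\<lambda>n. \<Prod>x\<in>{- int n..int n}. ?p ?\<eta>' x) \<longlonglongrightarrow> q * measure (product_blocking q) {\<eta>}"
    by (rule Lim_transform_eventually) 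
       (intro eventually_sequentiallyI[of "nat (\<bar>s\<bar> + 1)"], use eq in auto)
qed

text \<open>The step configuration picks the likelier value at each site
  \<open>x \<noteq> 0\<close>, with probability \<open>1 / (1 + q ^ nat \<bar>x\<bar>)\<close>. This
  is at least \<open>exp (- (q ^ nat \<bar>x\<bar>))\<close>, and the exponents are summable. It
  shows that the blocking measure conditions on an event of positive probability.\<close>

lemma product_blocking_step_pos:
  assumes q: "0 < q" "q < 1"
  shows "0 < measure (product_blocking q) {\<lambda>x. x > 0}"
proof -
  let ?p = "\<lambda>x :: int. pmf (bernoulli_pmf (occupancy q x)) (x > 0)"
  have factor: "exp (- (q ^ nat \<bar>x\<bar>)) \<le> ?p x" for x
  proof -
    have "?p x = 1 / (1 + q ^ nat \<bar>x\<bar>)"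
    proof (cases "x > 0")
      case True
      then have "q powi (- x) = 1 / q ^ nat \<bar>x\<bar>"
        by (simp add: power_int_minus power_int_def field_simps)
      then have "occupancy q x = 1 / q ^ nat \<bar>x\<bar> / (1 + 1 / q ^ nat \<bar>x\<bar>)"
        by (simp only: occupancy_def)
      also have "\<dots> = 1 / (1 + q ^ nat \<bar>x\<bar>)"
        using q by (simp add: field_simps)
      finally have "occupancy q x = 1 / (1 + q ^ nat \<bar>x\<bar>)" .
      then show ?thesis using occupancy_bounds[OF q(1), of x] True by simp
    next
      case False
      then have "q powi (- x) = q ^ nat \<bar>x\<bar>" by (simp add: power_int_def)
      then show ?thesis using occupancy_bounds[OF q(1), of x] False by simp
    qed
    moreover have "exp (- (q ^ nat \<bar>x\<bar>)) \<le> 1 / (1 + q ^ nat \<bar>x\<bar>)"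
      using exp_ge_add_one_self[of "q ^ nat \<bar>x\<bar>"] q by (simp add: exp_minus field_simps add_pos_pos)
    ultimately show ?thesis by simp
  qed
  \<comment> \<open>The bound is that of two geometric series, one for each half-line.\<close>
  have sum: "(\<Sum>x\<in>{- int n..int n}. q ^ nat \<bar>x\<bar>) \<le> 2 / (1 - q)" for n
  proof -
    have "(\<Sum>x\<in>{- int n..int n}. q ^ nat \<bar>x\<bar>) \<le> 2 * (\<Sum>k\<le>n. q ^ k)"
    proof (induction n)
      case (Suc n)
      have "{- int (Suc n)..int (Suc n)} = insert (int (Suc n)) (insert (- int (Suc n)) {- int n..int n})"
        by auto
      then show ?case using Suc by (simp add: nat_add_distrib)
    qed simp
    also have "(\<Sum>k\<le>n. q ^ k) \<le> 1 / (1 - q)"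
      using q by (subst sum_gp0) (auto simp: divide_right_mono)
    finally show ?thesis by simp
  qed
  have "exp (- (2 / (1 - q))) \<le> (\<Prod>x\<in>{- int n..int n}. ?p x)" for n
  proof -
    have "exp (- (2 / (1 - q))) \<le> exp (\<Sum>x\<in>{- int n..int n}. - (q ^ nat \<bar>x\<bar>))"
      using sum[of n] by (simp add: sum_negf)
    also have "\<dots> = (\<Prod>x\<in>{- int n..int n}. exp (- (q ^ nat \<bar>x\<bar>)))"
      by (simp add: exp_sum)
    also have "\<dots> \<le> (\<Prod>x\<in>{- int n..int n}. ?p x)"
      using factor by (intro prod_mono) auto
    finally show ?thesis .
  qed
  then have "exp (- (2 / (1 - q))) \<le> measure (product_blocking q) {\<lambda>x. x > 0}"
    by (intro LIMSEQ_le_const[OF product_blocking_singleton]) auto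
  then show ?thesis by (rule less_le_trans[rotated]) simp
qed

lemma step_in_configs_A: "(\<lambda>x. x > 0) \<in> configs_A"
  by (simp add: configs_A_iff not_le[symmetric])

lemma
  assumes q: "0 < q" "q < 1"
  shows prob_on_A_blocking: "prob_on_A (blocking q)"
    and blocking_singleton: "measure (blocking q) {\<eta>} =
      (if \<eta> \<in> configs_A then measure (product_blocking q) {\<eta>} / measure (product_blocking q) configs_A else 0)"
proof -
  interpret prob_space "product_blocking q"
    unfolding product_blocking_def by (intro prob_space_PiM measure_pmf.prob_space_axioms)
  have A: "configs_A \<in> sets (product_blocking q)" and single: "{\<eta>} \<in> sets (product_blocking q)" for \<eta>
    by (simp_all add: sets_product_blocking config_set_in_sets singleton_in_config_space)
  have "measure (product_blocking q) {\<lambda>x. x > 0} \<le> measure (product_blocking q) configs_A"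
    using step_in_configs_A A by (intro finite_measure_mono) auto
  then have pos: "emeasure (product_blocking q) configs_A \<noteq> 0"
    using product_blocking_step_pos[OF q] by (auto simp: emeasure_eq_measure)
  show "prob_on_A (blocking q)"
    unfolding prob_on_A_def
  proof (intro conjI)
    show "prob_space (blocking q)"
      unfolding blocking_def using pos by (intro prob_space_uniform_measure) (auto simp: emeasure_eq_measure)
    show "sets (blocking q) = sets config_space"
      by (simp add: blocking_def sets_product_blocking)
    show "AE \<eta> in blocking q. \<eta> \<in> configs_A"
      unfolding blocking_def using A by (intro AE_uniform_measureI) auto
  qed
  show "measure (blocking q) {\<eta>} =
      (if \<eta> \<in> configs_A then measure (product_blocking q) {\<eta>} / measure (product_blocking q) configs_A else 0)"
    unfolding blocking_def using pos A single
    by (subst measure_uniform_measure) (auto simp: emeasure_eq_measure)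
qed

lemma pmf_hecke:
  assumes "0 \<le> q" "q \<le> 1"
  shows "pmf (hecke q s h) k =
    (if h (s + 1) = h (s - 1) + 1 then
       if h s = h (s - 1) then q * of_bool (k = h(s := h s + 1)) + (1 - q) * of_bool (k = h)
       else of_bool (k = h(s := h (s - 1)))
     else of_bool (k = h))"
proof -
  have "pmf (hecke q s h) k = q * of_bool (k = flip s (True, True) h) + (1 - q) * of_bool (k = flip s (False, True) h)"
    using assms by (simp add: hecke_def map_pmf_def pmf_bind_bernoulli indicator_def of_bool_def eq_commute[of k])
  then show ?thesis by (auto simp: flip_def)
qed

text \<open>\<open>T s\<close> raises a lower corner with probability \<open>q\<close> and lowers an
  upper corner with probability 1, so the hypothesis on \<open>p\<close> is detailed balance for
  such a pair. Distinct heights not related by one raise at \<open>s\<close> do not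
  communicate.\<close>

lemma hecke_reversible:
  assumes q: "0 < q" "q < 1" and p: "set_pmf p \<subseteq> height_functions"
    and up: "\<And>h. h \<in> height_functions \<Longrightarrow> h (s + 1) = h (s - 1) + 1 \<Longrightarrow> h s = h (s - 1) \<Longrightarrow>
      pmf p (h(s := h s + 1)) = q * pmf p h"
  shows "p \<bind> hecke q s = p"
proof (rule detailed_balance_invariant)
  have le: "0 \<le> q" "q \<le> 1" using q by auto
  have raise: "pmf p h * pmf (hecke q s h) k = pmf p k * pmf (hecke q s k) h"
    if "h s < k s" "h \<in> height_functions" "k \<in> height_functions" for h k
  proof (cases "h (s + 1) = h (s - 1) + 1 \<and> h s = h (s - 1) \<and> k = h(s := h s + 1)")
    case True
    then have "h(s := h (s - 1)) = h" by auto
    then show ?thesis using True up[OF that(2)] q by (auto simp: pmf_hecke[OF le])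
  next
    case False
    have "pmf (hecke q s h) k = 0"
      using False that height_functionsD(2)[OF that(2), of s] by (auto simp: pmf_hecke[OF le])
    moreover have "pmf (hecke q s k) h = 0"
    proof (rule ccontr)
      assume nz: "pmf (hecke q s k) h \<noteq> 0"
      have "h \<noteq> k" using \<open>h s < k s\<close> by auto
      moreover have "h \<noteq> k(s := c)" if "k s \<le> c" for c
        using \<open>h s < k s\<close> that by auto
      ultimately have k: "k (s + 1) = k (s - 1) + 1" "k s \<noteq> k (s - 1)" "h = k(s := k (s - 1))"
        using nz by (auto simp: pmf_hecke[OF le] split: if_splits)
      then have eq: "k s = k (s - 1) + 1" using height_functionsD(2)[OF that(3), of s] by simp
      have "h(s := h s + 1) = k(s := k s)" by (simp add: k(3) eq)
      then have "k = h(s := h s + 1)" by simp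
      moreover have "h (s + 1) = h (s - 1) + 1" "h s = h (s - 1)" by (simp_all add: k)
      ultimately show False using False by blast
    qed
    ultimately show ?thesis by simp
  qed
  have stay: "k \<in> height_functions" if "h \<in> height_functions" "pmf (hecke q s h) k \<noteq> 0" for h k
    using that by (auto simp: set_pmf_iff[symmetric] hecke_def flip_in_height_functions)
  have outside: "pmf p h * pmf (hecke q s h) k = 0" if "h \<notin> height_functions \<or> k \<notin> height_functions" for h k
    using that stay p by (auto simp: set_pmf_iff)
  show "pmf p h * pmf (hecke q s h) k = pmf p k * pmf (hecke q s k) h" for h k
  proof (cases "h \<in> height_functions \<and> k \<in> height_functions")
    case True
    consider "h s < k s" | "k s < h s" | "h s = k s" by linarith
    then show ?thesis
    proof cases
      case 1
      then show ?thesis using True by (intro raise) auto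
    next
      case 2
      then show ?thesis using True by (intro raise[symmetric]) auto
    next
      case 3
      have zero: "pmf (hecke q s h) k = 0" if "h s = k s" "h \<noteq> k" for h k
      proof -
        have "k \<noteq> h(s := c)" if "h s \<noteq> c" for c
          using \<open>h s = k s\<close> that by (metis fun_upd_same)
        then show ?thesis using that(2) by (simp add: pmf_hecke[OF le] eq_commute[of k h])
      qed
      show ?thesis
      proof (cases "h = k")
        case False
        then show ?thesis using zero[of h k] zero[of k h] 3 by simp
      qed simp
    qed
  next
    case False
    then have "pmf p h * pmf (hecke q s h) k = 0" "pmf p k * pmf (hecke q s k) h = 0"
      using outside by blast+
    then show ?thesis by (rule trans[OF _ sym])
  qed
qed

lemma heights_A_fun_upd:
  assumes "h(s := a) \<in> height_functions" "h \<in> heights_A"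
  shows "h(s := a) \<in> heights_A"
proof -
  obtain m where "\<forall>x\<ge>m. h x = x - 1" using assms(2) by (auto simp: heights_A_def)
  then have "\<forall>x\<ge>max m (s + 1). (h(s := a)) x = x - 1" by auto
  then show ?thesis using assms(1) unfolding heights_A_def by blast
qed

text \<open>Raising a lower corner at \<open>s\<close> moves a particle from \<open>s\<close> to
  \<open>s - 1\<close>, which multiplies the product weight by \<open>q\<close>. Both configurations
  lie in \<open>configs_A\<close> or neither does, so the normalisation cancels.\<close>

lemma blocking_heights_pmf:
  assumes q: "0 < q" "q < 1"
  obtains p where "set_pmf p \<subseteq> configs_A" "blocking q = distr (measure_pmf p) config_space (\<lambda>\<eta>. \<eta>)"
    "\<And>s. map_pmf height p \<bind> hecke q s = map_pmf height p"
proof (rule config_measure_eq_pmf[OF prob_on_A_blocking[OF q]])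
  fix p assume set_p: "set_pmf p \<subseteq> configs_A" and distr_p: "blocking q = distr (measure_pmf p) config_space (\<lambda>\<eta>. \<eta>)"
    and pmf_p: "\<And>\<eta>. pmf p \<eta> = measure (blocking q) {\<eta>}"
  have pmf_h: "pmf (map_pmf height p) h = (if h \<in> heights_A then pmf p (config_of h) else 0)" for h
  proof (cases "h \<in> heights_A")
    case True
    have "measure p (height -` {h}) = measure p {config_of h}"
      using set_p True
      by (intro measure_pmf.finite_measure_eq_AE AE_pmfI) (auto simp: config_of_height height_config_of)
    then show ?thesis using True by (simp add: pmf_map measure_pmf_single)
  next
    case False
    then have "h \<notin> set_pmf (map_pmf height p)" using set_p height_in_heights_A by auto
    then show ?thesis using False by (simp add: pmf_eq_0_set_pmf)
  qed
  have "map_pmf height p \<bind> hecke q s = map_pmf height p" for s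
  proof (rule hecke_reversible[OF q])
    show "set_pmf (map_pmf height p) \<subseteq> height_functions"
      using set_p height_in_heights_A by (auto simp: heights_A_def)
    fix h assume h: "h \<in> height_functions" and low: "h (s + 1) = h (s - 1) + 1" "h s = h (s - 1)"
    let ?k = "h(s := h s + 1)"
    have k: "?k \<in> height_functions"
      using flip_in_height_functions[OF h, of s "(True, True)"] low by (simp add: flip_def)
    show "pmf (map_pmf height p) ?k = q * pmf (map_pmf height p) h"
    proof (cases "h \<in> heights_A")
      case True
      have kA: "?k \<in> heights_A" by (rule heights_A_fun_upd[OF k True])
      have "config_of ?k = (config_of h)(s - 1 := True, s := False)"
        using low by (auto simp: config_of_def fun_eq_iff)
      moreover have "\<not> config_of h (s - 1)" "config_of h s" using low by (auto simp: config_of_def)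
      ultimately show ?thesis
        using product_blocking_swap[of q "config_of h" s] q kA True config_of_in_configs_A[OF kA] config_of_in_configs_A[OF True]
        by (simp add: pmf_h pmf_p blocking_singleton[OF q])
    next
      case False
      have "?k \<notin> heights_A"
      proof
        assume "?k \<in> heights_A"
        then show False using heights_A_fun_upd[of ?k s "h s"] h False by simp
      qed
      then show ?thesis using False by (simp add: pmf_h)
    qed
  qed
  then show thesis using that set_p distr_p by blast
qed

subsection \<open>The six-vertex model as a sequence of local updates\<close>

lemma is_horizontal_horizontal:
  assumes "\<exists>m. \<forall>x\<le>m. \<not> v x"
  shows "is_horizontal s v (horizontal s v)"
  unfolding horizontal_def using is_horizontal_ex1[OF assms] by (rule theI')

lemma horizontal_step:
  assumes "\<exists>m. \<forall>x\<le>m. \<not> v x"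
  shows "horizontal s v (x + 1) = snd (vertex (s x) (v x) (horizontal s v x))"
  using is_horizontal_horizontal[OF assms] by (simp add: is_horizontal_def)

lemma horizontal_eqI:
  assumes "\<exists>m. \<forall>x\<le>m. \<not> v x" "is_horizontal s v h"
  shows "horizontal s v = h"
  using is_horizontal_ex1[OF assms(1)] is_horizontal_horizontal[OF assms(1)] assms(2) by blast

text \<open>The horizontal edge indexed by \<open>x\<close> leaves the vertex \<open>x - 1\<close>,
  hence emptiness extends to \<open>m + 1\<close>.\<close>

lemma horizontal_left_empty:
  assumes v: "\<And>x. x \<le> m \<Longrightarrow> \<not> v x" and x: "x \<le> m + 1"
  shows "\<not> horizontal s v x"
proof -
  have ex: "\<exists>m. \<forall>x\<le>m. \<not> v x" using v by blast
  obtain k where k: "\<And>x. x \<le> k \<Longrightarrow> \<not> horizontal s v x"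
    using is_horizontal_horizontal[OF ex, of s] by (auto simp: is_horizontal_def)
  show ?thesis
  proof (cases "x \<le> k")
    case False
    then have "k \<le> x" by simp
    then show ?thesis using x
    proof (induction x rule: int_ge_induct)
      case (step i)
      then show ?case using v[of i] by (simp add: horizontal_step[OF ex])
    qed (simp add: k)
  qed (rule k)
qed

lemma vertical_nonpos:
  assumes "\<And>x. x \<le> 0 \<Longrightarrow> \<not> \<eta> x" "x \<le> 0"
  shows "\<not> vertical C \<eta> \<omega> t x"
  using assms(2)
proof (induction t arbitrary: x)
  case (Suc t)
  then show ?case using horizontal_left_empty[of 0 "vertical C \<eta> \<omega> t" x] by simp
qed (simp add: assms(1))

text \<open>Before the update, site \<open>s\<close> carries the edge from below and site
  \<open>s - 1\<close> the edge from the left. Afterwards site \<open>s - 1\<close> carries the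
  upper edge, as the frame shifts by one per line, and site \<open>s\<close> the right edge.\<close>

lemma config_of_flip:
  assumes h: "h \<in> height_functions"
  shows "config_of (flip s c h) = (config_of h)
    (s - 1 := fst (vertex c (config_of h s) (config_of h (s - 1))),
     s := snd (vertex c (config_of h s) (config_of h (s - 1))))"
proof
  fix x
  have h': "h s = h (s - 1) \<or> h s = h (s - 1) + 1" "h (s + 1) = h s \<or> h (s + 1) = h s + 1"
    using height_functionsD[OF h, of s] by auto
  consider "x = s - 1" | "x = s" | "x \<noteq> s - 1" "x \<noteq> s" by blast
  then show "config_of (flip s c h) x = ((config_of h)
    (s - 1 := fst (vertex c (config_of h s) (config_of h (s - 1))),
     s := snd (vertex c (config_of h s) (config_of h (s - 1))))) x"
  proof cases
    case 3
    then show ?thesis by (auto simp: config_of_def flip_def)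
  qed (use h' in \<open>auto simp: config_of_def flip_def\<close>)
qed

text \<open>The sweep starts at column 1 because from the step configuration no path enters a vertex
  in a column up to 0.\<close>

primrec sweep :: "(int \<Rightarrow> bool \<times> bool) \<Rightarrow> nat \<Rightarrow> (int \<Rightarrow> int) \<Rightarrow> nat \<Rightarrow> int \<Rightarrow> int" where
  "sweep c t h 0 = h"
| "sweep c t h (Suc n) = flip (int (Suc n) - int t) (c (int (Suc n))) (sweep c t h n)"

lemma flip_in_heights_A:
  assumes "h \<in> heights_A"
  shows "flip s c h \<in> heights_A"
proof -
  have "h \<in> height_functions" using assms by (simp add: heights_A_def)
  from flip_in_height_functions[OF this, of s c] show ?thesis
    using assms by (cases "h (s + 1) = h (s - 1) + 1") (simp_all only: flip_def heights_A_fun_upd refl if_True if_False)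
qed

lemma sweep_in_heights_A: "h \<in> heights_A \<Longrightarrow> sweep c t h n \<in> heights_A"
  by (induction n) (auto intro: flip_in_heights_A)

lemma sweep_cong:
  "(\<And>x. x \<le> int n \<Longrightarrow> c x = c' x) \<Longrightarrow> sweep c t h n = sweep c' t h n"
  by (induction n) auto

text \<open>
  After the vertices up to \<open>n\<close> of line \<open>t\<close>, the configuration consists of the new edges on the left, the
  horizontal edge entering the vertex \<open>n + 1\<close>, and the old edges on the right.
\<close>

lemma config_of_sweep:
  fixes c :: "int \<Rightarrow> bool \<times> bool"
  assumes h: "h \<in> height_functions" and v: "\<And>x. x \<le> 0 \<Longrightarrow> \<not> v x" and hv: "config_of h = (\<lambda>p. v (p + int t))"
  defines "r \<equiv> horizontal c v"
  shows "config_of (sweep c t h n) = (\<lambda>p. if p < int n - int t then fst (vertex (c (p + 1 + int t)) (v (p + 1 + int t)) (r (p + 1 + int t)))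
     else if p = int n - int t then r (int n + 1) else v (p + int t))"
proof (induction n)
  case 0
  have "\<not> r x" if "x \<le> 1" for x unfolding r_def using horizontal_left_empty[of 0 v x c, OF v] that by simp
  then show ?case using v by (auto simp: hv fun_eq_iff)
next
  case (Suc n)
  have ex: "\<exists>m. \<forall>x\<le>m. \<not> v x" using v by blast
  have "sweep c t h n \<in> height_functions"
    by (induction n) (auto simp: h flip_in_height_functions)
  then have "config_of (sweep c t h (Suc n)) = (config_of (sweep c t h n))
    (int n - int t := fst (vertex (c (int n + 1)) (v (int n + 1)) (r (int n + 1))),
     int n + 1 - int t := snd (vertex (c (int n + 1)) (v (int n + 1)) (r (int n + 1))))"
    by (simp add: config_of_flip Suc.IH add.commute)
  also have "snd (vertex (c (int n + 1)) (v (int n + 1)) (r (int n + 1))) = r (2 + int n)"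
    using horizontal_step[OF ex, of c "int n + 1"] by (simp add: r_def)
  finally show ?case
    by (auto simp: Suc.IH fun_eq_iff)
qed

lemma vertex_turn: "vertex (False, False) a b = (b, a)"
  by (cases a; cases b) simp_all

primrec window_heights :: "nat \<Rightarrow> (int \<times> nat) set \<Rightarrow> (int \<times> nat \<Rightarrow> bool \<times> bool) \<Rightarrow> nat \<Rightarrow> int \<Rightarrow> int" where
  "window_heights n C \<omega> 0 = step_height"
| "window_heights n C \<omega> (Suc t) = sweep (\<lambda>x. choice_at C \<omega> (x, t)) t (window_heights n C \<omega> t) n"

lemma step_height_in_heights_A: "step_height \<in> heights_A"
  using step_height_in_height_functions
  by (auto simp: heights_A_def step_height_def intro!: exI[of _ 1])

lemma set_rows_heights_A: "set_pmf (rows_pmf q l) \<subseteq> heights_A"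
proof (induction l)
  case (Cons e l)
  have "eject_particle n e h \<in> heights_A" if h: "h \<in> heights_A" for n h
  proof -
    obtain m where "\<forall>x\<ge>m. h x = x - 1" using h by (auto simp: heights_A_def)
    then have "\<forall>x\<ge>max m (e + 1). eject_particle n e h x = x - 1" by (simp add: eject_particle_def)
    then show ?thesis using h eject_particle_in_height_functions unfolding heights_A_def by blast
  qed
  then show ?case using Cons.IH by (auto simp: row_pmf_def)
qed (simp add: step_height_in_heights_A)

lemma window_heights_in_heights_A: "window_heights n C \<omega> t \<in> heights_A"
  by (induction t) (auto simp: step_height_in_heights_A sweep_in_heights_A)

text \<open>A vertex that always turns exchanges its two edges. Beyond column \<open>n\<close> each
  line therefore moves one column to the right, which in shifted coordinates is no change at
  all.\<close>

lemma config_of_window_heights: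
  assumes C: "\<And>x t. int n < x \<Longrightarrow> (x, t) \<in> C"
  shows "config_of (window_heights n C \<omega> t) = shifted_s6v C (\<lambda>x. x > 0) \<omega> t"
proof (induction t)
  case 0
  show ?case by (auto simp: shifted_s6v_def config_of_def step_height_def fun_eq_iff)
next
  case (Suc t)
  let ?v = "vertical C (\<lambda>x. x > 0) \<omega> t" and ?c = "\<lambda>x. choice_at C \<omega> (x, t)"
  have v: "\<not> ?v x" if "x \<le> 0" for x using vertical_nonpos[of "\<lambda>x. x > 0"] that by simp
  then have ex: "\<exists>m. \<forall>x\<le>m. \<not> ?v x" by blast
  have turn: "?c x = (False, False)" if "int n < x" for x using C[OF that] by (simp add: choice_at_def)
  have r: "horizontal ?c ?v (x + 1) = ?v x" if "int n < x" for x
    by (simp add: horizontal_step[OF ex] turn that vertex_turn)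
  have "window_heights n C \<omega> t \<in> height_functions"
    using window_heights_in_heights_A by (simp add: heights_A_def)
  note sw = config_of_sweep[where c = ?c and t = t and n = n, OF this v]
  show ?case
  proof
    fix p
    show "config_of (window_heights n C \<omega> (Suc t)) p = shifted_s6v C (\<lambda>x. x > 0) \<omega> (Suc t) p"
      using sw Suc r[of "p + int t"] turn[of "p + 1 + int t"]
      by (auto simp: shifted_s6v_def vertex_turn algebra_simps)
  qed
qed

section \<open>The law of the window heights\<close>

text \<open>Since \<open>X\<close> does not depend on the coordinate \<open>z\<close>, it is
  independent of it. The proof splits \<open>z\<close> off the product space and sums over its
  finitely many values.\<close>

lemma product_law_step:
  fixes pc :: "'c :: finite pmf" and X :: "('i \<Rightarrow> 'c) \<Rightarrow> 'a"
  defines "M \<equiv> PiM (UNIV :: 'i set) (\<lambda>_. measure_pmf pc)"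
  assumes X: "X \<in> measurable M (count_space UNIV)" "distr M (count_space UNIV) X = measure_pmf p"
    and dep: "\<And>f c. X (f(z := c)) = X f"
  shows "(\<lambda>\<omega>. g (\<omega> z) (X \<omega>)) \<in> measurable M (count_space UNIV)" (is ?meas)
    and "distr M (count_space UNIV) (\<lambda>\<omega>. g (\<omega> z) (X \<omega>)) = measure_pmf (p \<bind> (\<lambda>x. map_pmf (\<lambda>c. g c x) pc))"
proof -
  let ?R = "PiM (UNIV - {z}) (\<lambda>_. measure_pmf pc)"
  interpret R: prob_space ?R by (intro prob_space_PiM measure_pmf.prob_space_axioms)
  have sp: "space M = UNIV" by (simp add: M_def space_PiM)
  have z[measurable]: "(\<lambda>\<omega>. \<omega> z) \<in> measurable M (count_space UNIV)"
    unfolding M_def by (rule measurable_compose[OF measurable_component_singleton[of z]]) auto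
  have XB[measurable]: "X -` B \<in> sets M" for B
    using measurable_sets[OF X(1), of B] by (simp add: sp)
  have zc[measurable]: "{\<omega>. \<omega> z = c} \<in> sets M" for c
    using measurable_sets[OF z, of "{c}"] by (simp add: sp vimage_def)
  have decomp: "(\<lambda>\<omega>. g (\<omega> z) (X \<omega>)) -` S = (\<Union>c. {\<omega>. \<omega> z = c} \<inter> X -` (g c -` S))" for S
    by auto
  show ?meas
    by (rule measurableI) (auto simp: decomp sp intro!: sets.finite_UN)
  \<comment> \<open>Resampling the coordinate \<open>z\<close> independently of all others
    reproduces the product measure.\<close>
  have split: "distr (measure_pmf pc \<Otimes>\<^sub>M ?R) M (\<lambda>(x, Y). Y(z := x)) = M"
    using distr_pair_PiM_eq_PiM[of "UNIV - {z}" "\<lambda>_. measure_pmf pc" z]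
    by (simp add: M_def measure_pmf.prob_space_axioms insert_absorb)
  have upd: "(\<lambda>(x, Y). Y(z := x)) \<in> measurable (measure_pmf pc \<Otimes>\<^sub>M ?R) M"
    unfolding M_def split_beta by (rule measurable_fun_upd[where J = "UNIV - {z}"]) auto
  have indep: "emeasure M ({\<omega>. \<omega> z \<in> D} \<inter> X -` B) = emeasure (measure_pmf pc) D * emeasure ?R {Y \<in> space ?R. X Y \<in> B}"
    if "{\<omega>. \<omega> z \<in> D} \<in> sets M" for D B
  proof -
    have "(\<lambda>Y. Y(z := undefined)) \<in> measurable ?R M"
      unfolding M_def by (rule measurable_fun_upd[where J = "UNIV - {z}"]) auto
    from measurable_sets[OF this XB[of B]] have RB: "{Y \<in> space ?R. X Y \<in> B} \<in> sets ?R"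
      by (simp add: vimage_def dep Int_def conj_commute)
    have "emeasure M ({\<omega>. \<omega> z \<in> D} \<inter> X -` B) =
        emeasure (measure_pmf pc \<Otimes>\<^sub>M ?R) ((\<lambda>(x, Y). Y(z := x)) -` ({\<omega>. \<omega> z \<in> D} \<inter> X -` B) \<inter> space (measure_pmf pc \<Otimes>\<^sub>M ?R))"
      by (subst split[symmetric], subst emeasure_distr[OF upd]) (use that in auto)
    also have "(\<lambda>(x, Y). Y(z := x)) -` ({\<omega>. \<omega> z \<in> D} \<inter> X -` B) \<inter> space (measure_pmf pc \<Otimes>\<^sub>M ?R) =
        D \<times> {Y \<in> space ?R. X Y \<in> B}"
      by (auto simp: space_pair_measure dep)
    also have "emeasure (measure_pmf pc \<Otimes>\<^sub>M ?R) \<dots> = emeasure (measure_pmf pc) D * emeasure ?R {Y \<in> space ?R. X Y \<in> B}"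
      using RB by (intro R.emeasure_pair_measure_Times) auto
    finally show ?thesis .
  qed
  have marg: "emeasure ?R {Y \<in> space ?R. X Y \<in> B} = emeasure (measure_pmf p) B" for B
  proof -
    have "emeasure (measure_pmf p) B = emeasure M (X -` B)"
      unfolding X(2)[symmetric] by (subst emeasure_distr[OF X(1)]) (simp_all add: sp)
    also have "\<dots> = emeasure ?R {Y \<in> space ?R. X Y \<in> B}"
      using indep[of UNIV B] measure_pmf.emeasure_space_1[of pc] sp sets.top[of M] by simp
    finally show ?thesis ..
  qed
  show "distr M (count_space UNIV) (\<lambda>\<omega>. g (\<omega> z) (X \<omega>)) = measure_pmf (p \<bind> (\<lambda>x. map_pmf (\<lambda>c. g c x) pc))"
  proof (rule measure_eqI)
    fix S assume "S \<in> sets (distr M (count_space UNIV) (\<lambda>\<omega>. g (\<omega> z) (X \<omega>)))"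
    have "emeasure (distr M (count_space UNIV) (\<lambda>\<omega>. g (\<omega> z) (X \<omega>))) S = emeasure M (\<Union>c. {\<omega>. \<omega> z = c} \<inter> X -` (g c -` S))"
      by (subst emeasure_distr[OF \<open>?meas\<close>]) (simp_all add: sp decomp)
    also have "\<dots> = (\<Sum>c\<in>UNIV. emeasure M ({\<omega>. \<omega> z = c} \<inter> X -` (g c -` S)))"
      by (rule sym, rule sum_emeasure) (auto simp: disjoint_family_on_def)
    also have "\<dots> = (\<Sum>c\<in>UNIV. emeasure (measure_pmf p) (g c -` S) * pmf pc c)"
      using indep[of "{_}"] zc by (simp add: marg emeasure_pmf_single mult.commute)
    also have "\<dots> = (\<integral>\<^sup>+c. emeasure (measure_pmf p) (g c -` S) \<partial>measure_pmf pc)"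
      by (subst nn_integral_measure_pmf) (simp add: nn_integral_count_space_finite mult.commute)
    also have "\<dots> = emeasure (measure_pmf (pc \<bind> (\<lambda>c. map_pmf (g c) p))) S"
      by (simp add: emeasure_bind_pmf)
    also have "pc \<bind> (\<lambda>c. map_pmf (g c) p) = p \<bind> (\<lambda>x. map_pmf (\<lambda>c. g c x) pc)"
      unfolding map_pmf_def by (rule bind_commute_pmf)
    finally show "emeasure (distr M (count_space UNIV) (\<lambda>\<omega>. g (\<omega> z) (X \<omega>))) S =
      emeasure (measure_pmf (p \<bind> (\<lambda>x. map_pmf (\<lambda>c. g c x) pc))) S" .
  qed simp
qed


text \<open>A censored vertex acts as the identity and any other as \<open>update\<close> with a
  fresh choice; both keep the law a mixture of row products. This is why the set \<open>C\<close>
  may be arbitrary.\<close>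

lemma choice_measure_law_step:
  fixes X :: "(int \<times> nat \<Rightarrow> bool \<times> bool) \<Rightarrow> int \<Rightarrow> int"
  assumes b: "0 < b\<^sub>1" "b\<^sub>1 < b\<^sub>2" "b\<^sub>2 < 1"
    and X: "X \<in> measurable (choice_measure b\<^sub>1 b\<^sub>2) (count_space UNIV)"
      "distr (choice_measure b\<^sub>1 b\<^sub>2) (count_space UNIV) X = measure_pmf (w \<bind> rows_pmf (b\<^sub>1 / b\<^sub>2))"
    and dep: "\<And>f c. X (f(z := c)) = X f" and hf: "\<And>\<omega>. X \<omega> \<in> height_functions"
    and Y: "Y = (\<lambda>\<omega>. flip s (choice_at C \<omega> z) (X \<omega>))"
  shows "Y \<in> measurable (choice_measure b\<^sub>1 b\<^sub>2) (count_space UNIV) \<and>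
    (\<exists>w. distr (choice_measure b\<^sub>1 b\<^sub>2) (count_space UNIV) Y = measure_pmf (w \<bind> rows_pmf (b\<^sub>1 / b\<^sub>2)))"
proof (cases "z \<in> C")
  case True
  have "flip s (False, False) h = h" if "h \<in> height_functions" for h
    using height_functionsD[OF that, of s] by (auto simp: flip_def)
  then have "Y = X" using True hf by (simp add: Y choice_at_def)
  then show ?thesis using X by auto
next
  case False
  then have Y': "Y = (\<lambda>\<omega>. flip s (\<omega> z) (X \<omega>))" by (simp add: Y choice_at_def)
  note law = product_law_step[of X, OF X[unfolded choice_measure_def] dep, where g = "flip s", folded choice_measure_def]
  obtain w' where "w \<bind> rows_pmf (b\<^sub>1 / b\<^sub>2) \<bind> update b\<^sub>1 b\<^sub>2 s = w' \<bind> rows_pmf (b\<^sub>1 / b\<^sub>2)"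
    using rows_bind_update[OF b] by blast
  then show ?thesis using law unfolding Y' update_def[abs_def] by auto
qed

text \<open>Together with the next lemma this shows that the choice at the next vertex has not yet
  been used.\<close>

lemma sweep_upd:
  assumes "int n < x"
  shows "sweep (\<lambda>y. choice_at C (f((x, t) := c)) (y, t)) t' h n = sweep (\<lambda>y. choice_at C f (y, t)) t' h n"
  using assms by (intro sweep_cong) (auto simp: choice_at_def)

lemma window_heights_upd:
  assumes "t \<le> s"
  shows "window_heights n C (f((x, s) := c)) t = window_heights n C f t"
  using assms
proof (induction t)
  case (Suc t)
  then have "(\<lambda>y. choice_at C (f((x, s) := c)) (y, t)) = (\<lambda>y. choice_at C f (y, t))"
    by (auto simp: choice_at_def fun_eq_iff)
  moreover have "window_heights n C (f((x, s) := c)) t = window_heights n C f t"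
    using Suc.IH Suc.prems by (meson Suc_leD)
  ultimately show ?case by (simp only: window_heights.simps)
qed simp

lemma window_heights_law:
  assumes b: "0 < b\<^sub>1" "b\<^sub>1 < b\<^sub>2" "b\<^sub>2 < 1"
  shows "(\<lambda>\<omega>. window_heights n C \<omega> t) \<in> measurable (choice_measure b\<^sub>1 b\<^sub>2) (count_space UNIV) \<and>
    (\<exists>w. distr (choice_measure b\<^sub>1 b\<^sub>2) (count_space UNIV) (\<lambda>\<omega>. window_heights n C \<omega> t) =
      measure_pmf (w \<bind> rows_pmf (b\<^sub>1 / b\<^sub>2)))"
proof (induction t)
  case 0
  interpret prob_space "choice_measure b\<^sub>1 b\<^sub>2"
    unfolding choice_measure_def by (intro prob_space_PiM measure_pmf.prob_space_axioms)
  have "distr (choice_measure b\<^sub>1 b\<^sub>2) (count_space UNIV) (\<lambda>\<omega>. step_height) = measure_pmf (return_pmf [] \<bind> rows_pmf (b\<^sub>1 / b\<^sub>2))"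
    by (simp add: bind_return_pmf return_pmf.rep_eq)
  then show ?case by (auto simp del: distr_const)
next
  case (Suc t)
  let ?S = "\<lambda>k \<omega>. sweep (\<lambda>x. choice_at C \<omega> (x, t)) t (window_heights n C \<omega> t) k"
  have "?S k \<in> measurable (choice_measure b\<^sub>1 b\<^sub>2) (count_space UNIV) \<and>
    (\<exists>w. distr (choice_measure b\<^sub>1 b\<^sub>2) (count_space UNIV) (?S k) = measure_pmf (w \<bind> rows_pmf (b\<^sub>1 / b\<^sub>2)))" for k
  proof (induction k)
    case 0
    then show ?case using Suc.IH by simp
  next
    case (Suc k)
    then obtain w where w: "?S k \<in> measurable (choice_measure b\<^sub>1 b\<^sub>2) (count_space UNIV)"
      "distr (choice_measure b\<^sub>1 b\<^sub>2) (count_space UNIV) (?S k) = measure_pmf (w \<bind> rows_pmf (b\<^sub>1 / b\<^sub>2))" by blast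
    show ?case
    proof (rule choice_measure_law_step[OF b w, where z = "(int (Suc k), t)" and s = "int (Suc k) - int t" and C = C])
      show "?S k (f((int (Suc k), t) := c)) = ?S k f" for f c
        by (simp add: sweep_upd window_heights_upd)
      show "?S k \<omega> \<in> height_functions" for \<omega>
        using sweep_in_heights_A[OF window_heights_in_heights_A] by (auto simp: heights_A_def)
    qed simp
  qed
  then show ?case by simp
qed

section \<open>Measurability and the effect of far columns\<close>

text \<open>The definite description in \<open>horizontal\<close> is avoided by building the
  horizontal edges recursively from the empty edge at column 1, so that each edge depends measurably
  on finitely many vertices.\<close>

lemma measurable_vertical:
  "(\<lambda>\<omega>. vertical C (\<lambda>x. x > 0) \<omega> t x) \<in> measurable (choice_measure b\<^sub>1 b\<^sub>2) (count_space UNIV)"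
proof (induction t arbitrary: x)
  case 0
  show ?case by simp
next
  case (Suc t)
  let ?M = "choice_measure b\<^sub>1 b\<^sub>2" and ?v = "\<lambda>\<omega>. vertical C (\<lambda>x. x > 0) \<omega> t"
  let ?r = "\<lambda>\<omega>. horizontal (\<lambda>y. choice_at C \<omega> (y, t)) (?v \<omega>)"
  have v: "\<not> ?v \<omega> x" if "x \<le> 0" for x \<omega> using vertical_nonpos[of "\<lambda>x. x > 0"] that by simp
  then have ex: "\<exists>m. \<forall>x\<le>m. \<not> ?v \<omega> x" for \<omega> by blast
  have [measurable]: "Measurable.pred ?M (\<lambda>\<omega>. ?v \<omega> x)" for x by (rule Suc.IH)
  have choice: "(\<lambda>\<omega>. choice_at C \<omega> z) \<in> measurable ?M (count_space UNIV)" for z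
  proof (cases "z \<in> C")
    case False
    then show ?thesis unfolding choice_measure_def
      by (auto simp: choice_at_def intro!: measurable_compose[OF measurable_component_singleton[of z]])
  qed (simp add: choice_at_def)
  have pred: "Measurable.pred ?M (\<lambda>\<omega>. P (choice_at C \<omega> z))" for P z
    by (rule measurable_compose[OF choice]) simp
  have [measurable]: "Measurable.pred ?M (\<lambda>\<omega>. fst (choice_at C \<omega> z))" "Measurable.pred ?M (\<lambda>\<omega>. snd (choice_at C \<omega> z))" for z
    by (rule pred)+
  have vertex_eq: "fst (vertex c a b) \<longleftrightarrow> a \<and> b \<or> a \<and> fst c \<or> b \<and> \<not> a \<and> \<not> snd c"
    "snd (vertex c a b) \<longleftrightarrow> a \<and> b \<or> a \<and> \<not> fst c \<or> b \<and> \<not> a \<and> snd c" for c a b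
    by (cases a; cases b; simp)+
  have [measurable]: "Measurable.pred ?M (\<lambda>\<omega>. ?r \<omega> x)" for x
  proof (cases "1 \<le> x")
    case True
    then show ?thesis
    proof (induction x rule: int_ge_induct)
      case base
      show ?case using horizontal_left_empty[of 0 "?v _" 1] v by simp
    next
      case (step i)
      note [measurable] = step.IH
      show ?case unfolding horizontal_step[OF ex] vertex_eq by measurable
    qed
  next
    case False
    then show ?thesis using horizontal_left_empty[of 0 "?v _" x] v by simp
  qed
  show ?case by (simp add: vertex_eq)
qed

lemma measurable_shifted_s6v:
  "(\<lambda>\<omega>. shifted_s6v C (\<lambda>x. x > 0) \<omega> t) \<in> measurable (choice_measure b\<^sub>1 b\<^sub>2) config_space"
  unfolding config_space_def shifted_s6v_def
  by (rule measurable_PiM_single') (auto intro: measurable_vertical simp: space_PiM)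

text \<open>By independence, going straight at \<open>k\<close> given vertices has probability
  \<open>b\<^sub>1 ^ k\<close>, which tends to 0; only countably many pairs \<open>t\<close>,
  \<open>m\<close> occur.\<close>

lemma AE_turn_eventually:
  assumes b: "0 < b\<^sub>1" "b\<^sub>1 < 1"
  shows "AE \<omega> in choice_measure b\<^sub>1 b\<^sub>2. \<forall>t m. \<exists>y\<ge>m. \<not> fst (\<omega> (y, t))"
proof -
  let ?pc = "pair_pmf (bernoulli_pmf b\<^sub>1) (bernoulli_pmf b\<^sub>2)"
  interpret product_prob_space "\<lambda>_. measure_pmf ?pc" "UNIV :: (int \<times> nat) set"
    by (intro product_prob_spaceI measure_pmf.prob_space_axioms)
  have straight: "measure (measure_pmf ?pc) {c. fst c} = b\<^sub>1"
  proof -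
    have "measure (measure_pmf ?pc) {c. fst c} = measure (measure_pmf (map_pmf fst ?pc)) {True}"
      by (simp add: vimage_def)
    also have "\<dots> = b\<^sub>1" using b by (simp add: map_fst_pair_pmf measure_pmf_single)
    finally show ?thesis .
  qed
  have "AE \<omega> in choice_measure b\<^sub>1 b\<^sub>2. \<exists>y\<ge>m. \<not> fst (\<omega> (y, t))" for t m
  proof -
    let ?E = "\<lambda>k. {\<omega> \<in> space (choice_measure b\<^sub>1 b\<^sub>2). \<forall>z\<in>{m..<m + int k} \<times> {t}. \<omega> z \<in> {c. fst c}}"
    have "measure (choice_measure b\<^sub>1 b\<^sub>2) (?E k) = b\<^sub>1 ^ k" for k
    proof -
      have "emeasure (choice_measure b\<^sub>1 b\<^sub>2) (?E k) = (\<Prod>z\<in>{m..<m + int k} \<times> {t}. emeasure (measure_pmf ?pc) {c. fst c})"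
        unfolding choice_measure_def by (rule emeasure_PiM_Collect) auto
      also have "\<dots> = ennreal (b\<^sub>1 ^ k)"
        using b by (simp add: measure_pmf.emeasure_eq_measure straight card_cartesian_product ennreal_power)
      finally show ?thesis using b by (simp add: measure_def)
    qed
    note Ek = this
    have E: "?E k \<in> sets (choice_measure b\<^sub>1 b\<^sub>2)" for k
      unfolding choice_measure_def by (intro sets.sets_Collect_finite_All) (auto intro!: sets_Collect_single')
    then have EI: "(\<Inter>k. ?E k) \<in> sets (choice_measure b\<^sub>1 b\<^sub>2)"
      by (intro sets.countable_INT) auto
    interpret ch: prob_space "choice_measure b\<^sub>1 b\<^sub>2"
      unfolding choice_measure_def by (intro prob_space_PiM measure_pmf.prob_space_axioms)
    have "measure (choice_measure b\<^sub>1 b\<^sub>2) (\<Inter>k. ?E k) \<le> b\<^sub>1 ^ k" for k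
      unfolding Ek[of k, symmetric] using E by (intro ch.finite_measure_mono INT_lower) auto
    then have "measure (choice_measure b\<^sub>1 b\<^sub>2) (\<Inter>k. ?E k) \<le> 0"
      using b by (intro LIMSEQ_le_const[OF LIMSEQ_power_zero[of b\<^sub>1]]) auto
    then have "(\<Inter>k. ?E k) \<in> null_sets (choice_measure b\<^sub>1 b\<^sub>2)"
      using EI by (intro null_setsI) (simp_all add: ch.emeasure_eq_measure ennreal_eq_0_iff)
    then show ?thesis
      by (rule AE_I') auto
  qed
  then show ?thesis by (simp add: AE_all_countable)
qed

text \<open>Each line is full from some column on. After the first turn in the full region the
  horizontal edges are full as well, and a vertex with two incoming paths does not consult its
  choice, so censoring it changes nothing.\<close>

lemma shifted_s6v_eq_window:
  assumes turn: "\<forall>t m. \<exists>y\<ge>m. \<not> fst (\<omega> (y, t))"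
  shows "\<exists>n0. \<forall>n\<ge>n0. vertical (C \<union> {z. int n < fst z}) (\<lambda>x. x > 0) \<omega> t = vertical C (\<lambda>x. x > 0) \<omega> t"
proof -
  \<comment> \<open>Fullness far to the right is included in the claim so that the induction can
    pass to the next line.\<close>
  have "\<exists>n0 m. (\<forall>n\<ge>n0. vertical (C \<union> {z. int n < fst z}) (\<lambda>x. x > 0) \<omega> t = vertical C (\<lambda>x. x > 0) \<omega> t) \<and>
      (\<forall>x\<ge>m. vertical C (\<lambda>x. x > 0) \<omega> t x)"
  proof (induction t)
    case 0
    show ?case by (auto intro!: exI[of _ 1])
  next
    case (Suc t)
    let ?C = "\<lambda>n :: nat. C \<union> {z. int n < fst z}"
    let ?v = "vertical C (\<lambda>x. x > 0) \<omega> t" and ?c = "\<lambda>x. choice_at C \<omega> (x, t)"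
    obtain n0 m where n0: "\<And>n. n0 \<le> n \<Longrightarrow> vertical (?C n) (\<lambda>x. x > 0) \<omega> t = ?v"
      and m: "\<And>x. m \<le> x \<Longrightarrow> ?v x" using Suc.IH by blast
    obtain y where y: "m \<le> y" "\<not> fst (\<omega> (y, t))" using turn by blast
    have ex: "\<exists>m. \<forall>x\<le>m. \<not> ?v x" using vertical_nonpos[of "\<lambda>x. x > 0"] by (intro exI[of _ 0]) simp
    let ?r = "horizontal ?c ?v"
    have r: "?r x" if "y + 1 \<le> x" for x
      using that
    proof (induction x rule: int_ge_induct)
      case base
      have "\<not> fst (?c y)" using y by (simp add: choice_at_def)
      then show ?case using m[OF y(1)] by (cases "?r y") (simp_all add: horizontal_step[OF ex])
    next
      case (step i)
      then show ?case using m[of i] y(1) by (simp add: horizontal_step[OF ex])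
    qed
    have "vertical (?C n) (\<lambda>x. x > 0) \<omega> (Suc t) = vertical C (\<lambda>x. x > 0) \<omega> (Suc t)" if n: "max n0 (nat (y + 1)) \<le> n" for n
    proof -
      let ?c' = "\<lambda>x. choice_at (?C n) \<omega> (x, t)"
      have same: "?c' x = ?c x \<or> ?v x \<and> ?r x" for x
        using n r[of x] m[of x] y(1) by (auto simp: choice_at_def)
      have same_vertex: "vertex (?c' x) (?v x) (?r x) = vertex (?c x) (?v x) (?r x)" for x
        using same[of x] by auto
      have "is_horizontal ?c' ?v ?r"
        using is_horizontal_horizontal[OF ex, of ?c] by (simp add: is_horizontal_def same_vertex)
      then have "horizontal ?c' ?v = ?r" by (rule horizontal_eqI[OF ex])
      then show ?thesis using n0[of n] n by (simp add: same_vertex)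
    qed
    moreover have "vertical C (\<lambda>x. x > 0) \<omega> (Suc t) x" if "y + 1 \<le> x" for x
      using r[OF that] m[of x] y(1) that by simp
    ultimately show ?case by blast
  qed
  then show ?thesis by blast
qed

subsection \<open>Passage to the limit\<close>

text \<open>The couplings live on a countable set, so a subsequence converges pointwise. By Fatou
  the first marginal of the limit is at most \<open>p'\<close>. No second coordinate loses mass,
  because the first marginals converge to a probability and are therefore tight. Comparing total
  masses turns both inequalities into equalities.\<close>

lemma rel_pmf_limit:
  fixes p :: "nat \<Rightarrow> 'a pmf"
  assumes rel: "\<And>n. rel_pmf R (p n) r" and lim: "\<And>x. (\<lambda>n. pmf (p n) x) \<longlonglongrightarrow> pmf p' x"
  shows "rel_pmf R p' r"
proof -
  have "\<forall>n. \<exists>c. (\<forall>(x, y)\<in>set_pmf c. R x y) \<and> map_pmf fst c = p n \<and> map_pmf snd c = r"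
    using rel unfolding rel_pmf.simps by blast
  then obtain c where c: "\<And>n x y. (x, y) \<in> set_pmf (c n) \<Longrightarrow> R x y"
    "\<And>n. map_pmf fst (c n) = p n" "\<And>n. map_pmf snd (c n) = r"
    by (metis case_prodD)
  let ?S = "\<Union>n. set_pmf (c n)"
  have "countable ?S" by (intro countable_UN) auto
  then obtain k l where k: "strict_mono k" and l: "\<And>z. z \<in> ?S \<Longrightarrow> (\<lambda>n. pmf (c (k n)) z) \<longlonglongrightarrow> l z"
    using function_convergent_subsequence[of ?S "\<lambda>n z. pmf (c n) z" 1]
    by (simp add: pmf_le_1) metis
  define g where "g z = (if z \<in> ?S then l z else 0)" for z
  have g: "(\<lambda>n. pmf (c (k n)) z) \<longlonglongrightarrow> g z" for z
  proof (cases "z \<in> ?S")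
    case False
    then have "pmf (c n) z = 0" for n by (auto simp: set_pmf_iff)
    then show ?thesis using False by (simp add: g_def)
  qed (simp add: g_def l)
  have g_nonneg: "0 \<le> g z" for z
    using g[of z] by (intro LIMSEQ_le_const[of _ "g z" 0]) auto
  have lim_k: "(\<lambda>n. pmf (p (k n)) x) \<longlonglongrightarrow> pmf p' x" for x
    using LIMSEQ_subseq_LIMSEQ[OF lim k] by (simp add: comp_def)
  \<comment> \<open>Up to the mass of the first marginal outside the finite set \<open>X\<close>,
    the mass of \<open>y\<close> sits on \<open>X \<times> {y}\<close>; a finite sum passes to the
    limit.\<close>
  have snd_ge: "pmf r y - measure p' (- X) \<le> (\<Sum>x\<in>X. g (x, y))" if "finite X" for y X
  proof (rule LIMSEQ_le)
    show "(\<lambda>n. \<Sum>x\<in>X. pmf (c (k n)) (x, y)) \<longlonglongrightarrow> (\<Sum>x\<in>X. g (x, y))"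
      by (intro tendsto_sum g)
    have compl: "measure q (- X) = 1 - (\<Sum>x\<in>X. pmf q x)" for q :: "'a pmf"
      using measure_pmf.prob_compl[of X q] that by (simp add: measure_measure_pmf_finite Compl_eq_Diff_UNIV)
    show "(\<lambda>n. pmf r y - measure (p (k n)) (- X)) \<longlonglongrightarrow> pmf r y - measure p' (- X)"
      unfolding compl by (intro tendsto_intros lim_k)
    have "pmf r y - measure (p n) (- X) \<le> (\<Sum>x\<in>X. pmf (c n) (x, y))" for n
    proof -
      have "pmf r y = measure (c n) (snd -` {y})" using c(3)[of n] by (metis pmf_map)
      also have "\<dots> \<le> measure (c n) (X \<times> {y} \<union> fst -` (- X))"
        by (intro measure_pmf.finite_measure_mono) auto
      also have "\<dots> \<le> measure (c n) (X \<times> {y}) + measure (c n) (fst -` (- X))"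
        by (intro measure_Un_le) auto
      also have "measure (c n) (fst -` (- X)) = measure (p n) (- X)"
        using c(2)[of n] by (metis measure_map_pmf)
      also have "measure (c n) (X \<times> {y}) = (\<Sum>x\<in>X. pmf (c n) (x, y))"
        using that by (simp add: measure_measure_pmf_finite sum.cartesian_product')
      finally show ?thesis by simp
    qed
    then show "\<exists>N. \<forall>n\<ge>N. pmf r y - measure (p (k n)) (- X) \<le> (\<Sum>x\<in>X. pmf (c (k n)) (x, y))" by blast
  qed
  have fst_pmf: "(\<integral>\<^sup>+y. pmf d (x, y) \<partial>count_space UNIV) = pmf (map_pmf fst d) x" for d :: "('a \<times> 'b) pmf" and x
  proof -
    have "(\<integral>\<^sup>+y. pmf d (x, y) \<partial>count_space UNIV) = (\<integral>\<^sup>+z. pmf d z \<partial>count_space ({x} \<times> UNIV))"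
      by (rule nn_integral_bij_count_space) (auto simp: bij_betw_def inj_on_def)
    also have "{x} \<times> UNIV = fst -` {x}" by auto
    finally show ?thesis by (simp add: nn_integral_pmf pmf_map measure_pmf.emeasure_eq_measure)
  qed
  have snd_pmf: "(\<integral>\<^sup>+x. pmf d (x, y) \<partial>count_space UNIV) = pmf (map_pmf snd d) y" for d :: "('a \<times> 'b) pmf" and y
  proof -
    have "(\<integral>\<^sup>+x. pmf d (x, y) \<partial>count_space UNIV) = (\<integral>\<^sup>+z. pmf d z \<partial>count_space (UNIV \<times> {y}))"
      by (rule nn_integral_bij_count_space) (auto simp: bij_betw_def inj_on_def)
    also have "UNIV \<times> {y} = snd -` {y}" by auto
    finally show ?thesis by (simp add: nn_integral_pmf pmf_map measure_pmf.emeasure_eq_measure)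
  qed
  have fst_le: "(\<integral>\<^sup>+y. g (x, y) \<partial>count_space UNIV) \<le> pmf p' x" for x
  proof -
    have "(\<integral>\<^sup>+y. g (x, y) \<partial>count_space UNIV) = (\<integral>\<^sup>+y. liminf (\<lambda>n. ennreal (pmf (c (k n)) (x, y))) \<partial>count_space UNIV)"
      by (intro nn_integral_cong lim_imp_Liminf[symmetric] tendsto_ennrealI g) simp
    also have "\<dots> \<le> liminf (\<lambda>n. \<integral>\<^sup>+y. pmf (c (k n)) (x, y) \<partial>count_space UNIV)"
      by (rule nn_integral_liminf) simp
    also have "\<dots> = pmf p' x"
      unfolding fst_pmf c(2) by (intro lim_imp_Liminf tendsto_ennrealI lim_k) simp
    finally show ?thesis .
  qed
  have snd_ge': "pmf r y \<le> (\<integral>\<^sup>+x. g (x, y) \<partial>count_space UNIV)" for y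
  proof -
    \<comment> \<open>Finite sets exhausting the support of \<open>p'\<close>.\<close>
    let ?X = "\<lambda>n. from_nat_into (set_pmf p') ` {..n :: nat}"
    have "(\<lambda>n. measure p' (?X n)) \<longlonglongrightarrow> measure p' (\<Union>n. ?X n)"
      by (intro measure_pmf.finite_Lim_measure_incseq) (auto simp: incseq_def)
    moreover have "(\<Union>n. ?X n) = set_pmf p'"
      unfolding image_UN[symmetric] UN_atMost_UNIV
      by (rule range_from_nat_into[OF set_pmf_not_empty countable_set_pmf])
    moreover have "measure p' (set_pmf p') = 1"
      by (subst measure_pmf.prob_eq_1) (auto simp: AE_measure_pmf_iff)
    ultimately have "(\<lambda>n. measure p' (?X n)) \<longlonglongrightarrow> 1"
      by simp
    then have "(\<lambda>n. ennreal (pmf r y - (1 - measure p' (?X n)))) \<longlonglongrightarrow> ennreal (pmf r y - (1 - 1))"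
      by (intro tendsto_ennrealI tendsto_intros)
    then have lim_r: "(\<lambda>n. ennreal (pmf r y - measure p' (- ?X n))) \<longlonglongrightarrow> ennreal (pmf r y)"
      using measure_pmf.prob_compl[of "?X _" p'] by (simp add: Compl_eq_Diff_UNIV)
    have "ennreal (pmf r y - measure p' (- ?X n)) \<le> (\<integral>\<^sup>+x. g (x, y) \<partial>count_space UNIV)" for n
    proof -
      have "ennreal (pmf r y - measure p' (- ?X n)) \<le> ennreal (\<Sum>x\<in>?X n. g (x, y))"
        by (intro ennreal_leI snd_ge) auto
      also have "\<dots> = (\<integral>\<^sup>+x. g (x, y) \<partial>count_space (?X n))"
        by (simp add: nn_integral_count_space_finite g_nonneg)
      also have "\<dots> \<le> (\<integral>\<^sup>+x. g (x, y) \<partial>count_space UNIV)"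
        by (subst nn_integral_count_space_indicator) (auto intro!: nn_integral_mono simp: indicator_def)
      finally show ?thesis .
    qed
    then show ?thesis by (intro LIMSEQ_le_const2[OF lim_r]) auto
  qed
  have total: "(\<integral>\<^sup>+z. g z \<partial>count_space UNIV) = 1"
  proof (rule antisym)
    have "(\<integral>\<^sup>+z. g z \<partial>count_space UNIV) = (\<integral>\<^sup>+x. \<integral>\<^sup>+y. g (x, y) \<partial>count_space UNIV \<partial>count_space UNIV)"
      by (rule nn_integral_fst_count_space[symmetric])
    also have "\<dots> \<le> (\<integral>\<^sup>+x. pmf p' x \<partial>count_space UNIV)"
      by (intro nn_integral_mono fst_le)
    finally show "(\<integral>\<^sup>+z. g z \<partial>count_space UNIV) \<le> 1" by (simp add: nn_integral_pmf)
    have "1 = (\<integral>\<^sup>+y. pmf r y \<partial>count_space UNIV)" by (simp add: nn_integral_pmf)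
    also have "\<dots> \<le> (\<integral>\<^sup>+y. \<integral>\<^sup>+x. g (x, y) \<partial>count_space UNIV \<partial>count_space UNIV)"
      by (intro nn_integral_mono snd_ge')
    also have "\<dots> = (\<integral>\<^sup>+z. g z \<partial>count_space UNIV)"
      by (rule nn_integral_snd_count_space)
    finally show "1 \<le> (\<integral>\<^sup>+z. g z \<partial>count_space UNIV)" .
  qed
  define d where "d = embed_pmf g"
  have d: "pmf d z = g z" for z
    unfolding d_def using total by (intro pmf_embed_pmf g_nonneg)
  have "map_pmf fst d = p'"
  proof (rule pmf_eqI_le)
    show "pmf (map_pmf fst d) x \<le> pmf p' x" for x
      using fst_le[of x] fst_pmf[of d x] by (simp add: d)
  qed
  moreover have "r = map_pmf snd d"
  proof (rule pmf_eqI_le)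
    show "pmf r y \<le> pmf (map_pmf snd d) y" for y
      using snd_ge'[of y] snd_pmf[of d y] by (simp add: d)
  qed
  moreover have "R x y" if "(x, y) \<in> set_pmf d" for x y
    using that c(1) by (auto simp: set_pmf_iff d g_def split: if_splits)
  ultimately show ?thesis by (intro rel_pmf.intros[of d]) auto
qed

theorem theorem1p8:
  fixes b\<^sub>1 b\<^sub>2 :: real and C :: "(int \<times> nat) set" and t :: nat
  assumes "0 < b\<^sub>1" and "b\<^sub>1 < b\<^sub>2" and "b\<^sub>2 < 1"
  shows "s6v_law C b\<^sub>1 b\<^sub>2 (\<lambda>x. x > 0) t \<preceq> blocking (b\<^sub>1 / b\<^sub>2)"
proof -
  let ?q = "b\<^sub>1 / b\<^sub>2" and ?M = "choice_measure b\<^sub>1 b\<^sub>2"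
  have q: "0 < ?q" "?q < 1" using assms by auto
  interpret prob_space ?M
    unfolding choice_measure_def by (intro prob_space_PiM measure_pmf.prob_space_axioms)
  let ?C = "\<lambda>n :: nat. C \<union> {z. int n < fst z}"
  let ?X = "\<lambda>C \<omega>. shifted_s6v C (\<lambda>x. x > 0) \<omega> t"
  have window: "config_of (window_heights n (?C n) \<omega> t) = ?X (?C n) \<omega>" for n \<omega>
    by (rule config_of_window_heights) auto
  \<comment> \<open>For almost every sample, the process with all columns beyond \<open>n\<close>
    censored equals the original one at time \<open>t\<close> for large \<open>n\<close>.\<close>
  have agree: "AE \<omega> in ?M. \<exists>n0. \<forall>n\<ge>n0. ?X (?C n) \<omega> = ?X C \<omega>"
  proof (rule AE_mp[OF AE_turn_eventually[of b\<^sub>1 b\<^sub>2]], use assms in simp_all, intro AE_I2 impI)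
    fix \<omega> :: "int \<times> nat \<Rightarrow> bool \<times> bool" assume "\<forall>t m. \<exists>y\<ge>m. \<not> fst (\<omega> (y, t))"
    from shifted_s6v_eq_window[OF this, of C t]
    obtain n0 where "\<forall>n\<ge>n0. vertical (?C n) (\<lambda>x. x > 0) \<omega> t = vertical C (\<lambda>x. x > 0) \<omega> t" by blast
    then show "\<exists>n0. \<forall>n\<ge>n0. ?X (?C n) \<omega> = ?X C \<omega>"
      unfolding shifted_s6v_def by (intro exI[of _ n0]) simp
  qed
  have law_A: "prob_on_A (s6v_law C b\<^sub>1 b\<^sub>2 (\<lambda>x. x > 0) t)"
    unfolding prob_on_A_def s6v_law_def
  proof (intro conjI)
    show "prob_space (distr ?M config_space (?X C))"
      by (rule prob_space_distr[OF measurable_shifted_s6v])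
    have "AE \<omega> in ?M. ?X C \<omega> \<in> configs_A"
      using agree
    proof (rule AE_mp, intro AE_I2 impI)
      fix \<omega> assume "\<exists>n0. \<forall>n\<ge>n0. ?X (?C n) \<omega> = ?X C \<omega>"
      then obtain n where "?X C \<omega> = ?X (?C n) \<omega>" by (metis order_refl)
      then show "?X C \<omega> \<in> configs_A"
        unfolding window[symmetric] using config_of_in_configs_A[OF window_heights_in_heights_A] by metis
    qed
    then show "AE \<eta> in distr ?M config_space (?X C). \<eta> \<in> configs_A"
      by (subst AE_distr_iff[OF measurable_shifted_s6v]) (auto simp: config_set_in_sets space_config_space)
  qed simp
  obtain p where set_p: "set_pmf p \<subseteq> configs_A"
    and p: "s6v_law C b\<^sub>1 b\<^sub>2 (\<lambda>x. x > 0) t = distr (measure_pmf p) config_space (\<lambda>\<eta>. \<eta>)"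
    and pmf_p: "\<And>\<eta>. pmf p \<eta> = measure (s6v_law C b\<^sub>1 b\<^sub>2 (\<lambda>x. x > 0) t) {\<eta>}"
    using config_measure_eq_pmf[OF law_A] by blast
  obtain r where set_r: "set_pmf r \<subseteq> configs_A"
    and r: "blocking ?q = distr (measure_pmf r) config_space (\<lambda>\<eta>. \<eta>)"
    and inv: "\<And>s. map_pmf height r \<bind> hecke ?q s = map_pmf height r"
    using blocking_heights_pmf[OF q] by blast
  let ?R = "\<lambda>\<xi> \<eta>. \<xi> \<in> configs_A \<and> \<eta> \<in> configs_A \<and> height \<xi> \<le> height \<eta>"
  have "\<exists>w. distr ?M (count_space UNIV) (\<lambda>\<omega>. window_heights n (?C n) \<omega> t) = measure_pmf (w \<bind> rows_pmf ?q)" for n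
    using window_heights_law[OF assms] by blast
  then obtain w where w: "\<And>n. distr ?M (count_space UNIV) (\<lambda>\<omega>. window_heights n (?C n) \<omega> t) = measure_pmf (w n \<bind> rows_pmf ?q)"
    by metis
  let ?p = "\<lambda>n. map_pmf config_of (w n \<bind> rows_pmf ?q)"
  have dominated: "rel_pmf ?R (?p n) r" for n
  proof -
    \<comment> \<open>The blocking heights are written as a constant mixture over
      \<open>w n\<close>, so that domination can be checked for each list separately.\<close>
    have "rel_pmf (\<le>) (w n \<bind> rows_pmf ?q) (w n \<bind> (\<lambda>_. map_pmf height r))"
    proof (rule rel_pmf_bindI)
      show "rel_pmf (=) (w n) (w n)" by (simp add: pmf.rel_eq)
      show "rel_pmf (\<le>) (rows_pmf ?q l) (map_pmf height r)" for l
        using set_r height_in_heights_A step_height_le_height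
        by (intro rows_le_invariant[OF q _ inv]) (auto simp: heights_A_def)
    qed
    then have "rel_pmf (\<lambda>h \<eta>. h \<le> height \<eta>) (w n \<bind> rows_pmf ?q) r"
      by (simp add: bind_pmf_const pmf.rel_map)
    then show ?thesis
      unfolding pmf.rel_map
      by (rule pmf.rel_mono_strong)
         (use set_r set_rows_heights_A in \<open>auto simp: height_config_of subset_iff intro!: config_of_in_configs_A\<close>)
  qed
  have X_meas: "?X D \<in> measurable ?M config_space" for D by (rule measurable_shifted_s6v)
  have event: "{\<omega> \<in> space ?M. ?X D \<omega> = \<eta>} \<in> sets ?M" for D \<eta>
    using measurable_sets[OF X_meas singleton_in_config_space, of D \<eta>] by (simp add: vimage_def Int_def conj_commute)
  have pmf_pn: "pmf (?p n) \<eta> = prob {\<omega> \<in> space ?M. ?X (?C n) \<omega> = \<eta>}" for n \<eta>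
  proof -
    have "pmf (?p n) \<eta> = measure (distr ?M (count_space UNIV) (\<lambda>\<omega>. window_heights n (?C n) \<omega> t)) (config_of -` {\<eta>})"
      by (simp only: pmf_map w)
    also have "\<dots> = prob {\<omega> \<in> space ?M. ?X (?C n) \<omega> = \<eta>}"
      using window_heights_law[OF assms, of n "?C n" t]
      by (subst measure_distr) (auto simp: window intro!: arg_cong[where f = prob])
    finally show ?thesis .
  qed
  \<comment> \<open>The events that the configuration equals \<open>\<eta>\<close> have almost
    surely convergent indicators, so dominated convergence applies.\<close>
  have limit: "(\<lambda>n. pmf (?p n) \<eta>) \<longlonglongrightarrow> pmf p \<eta>" for \<eta>
  proof -
    let ?I = "\<lambda>D. indicator {\<omega> \<in> space ?M. ?X D \<omega> = \<eta>} :: _ \<Rightarrow> real"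
    have "(\<lambda>n. integral\<^sup>L ?M (?I (?C n))) \<longlonglongrightarrow> integral\<^sup>L ?M (?I C)"
    proof (rule integral_dominated_convergence[where w = "\<lambda>_. 1"])
      show "AE \<omega> in ?M. (\<lambda>n. ?I (?C n) \<omega>) \<longlonglongrightarrow> ?I C \<omega>"
        using agree
      proof (rule AE_mp, intro AE_I2 impI)
        fix \<omega> assume "\<exists>n0. \<forall>n\<ge>n0. ?X (?C n) \<omega> = ?X C \<omega>"
        then obtain n0 where "\<forall>n\<ge>n0. ?X (?C n) \<omega> = ?X C \<omega>" by blast
        then have "eventually (\<lambda>n. ?I (?C n) \<omega> = ?I C \<omega>) sequentially"
          by (intro eventually_sequentiallyI[of n0]) (simp add: indicator_def)
        then show "(\<lambda>n. ?I (?C n) \<omega>) \<longlonglongrightarrow> ?I C \<omega>" by (rule tendsto_eventually)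
      qed
    qed (use event in auto)
    moreover have "pmf p \<eta> = prob {\<omega> \<in> space ?M. ?X C \<omega> = \<eta>}"
      unfolding pmf_p s6v_law_def
      by (subst measure_distr[OF X_meas singleton_in_config_space]) (auto intro!: arg_cong[where f = prob])
    ultimately show ?thesis
      using event by (simp add: pmf_pn)
  qed
  have "rel_pmf ?R p r" by (rule rel_pmf_limit[OF dominated limit])
  then obtain c where c: "\<And>\<xi> \<eta>. (\<xi>, \<eta>) \<in> set_pmf c \<Longrightarrow> height \<xi> \<le> height \<eta>"
    and c_fst: "map_pmf fst c = p" and c_snd: "map_pmf snd c = r"
    by (auto elim!: rel_pmf.cases)
  let ?N = "config_space \<Otimes>\<^sub>M config_space"
  \<comment> \<open>The coupling \<open>c\<close> lists the dominated configuration first, whereas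
    domination is defined with the dominating one first.\<close>
  let ?D = "distr (measure_pmf c) ?N prod.swap"
  have swap: "prod.swap \<in> measurable (measure_pmf c) ?N"
    by (simp add: measurable_def space_pair_measure space_config_space)
  have [simp]: "f \<in> measurable (measure_pmf c) config_space" for f :: "_ \<Rightarrow> config"
    by (simp add: measurable_def space_config_space)
  have marginal: "distr (measure_pmf c) config_space f = distr (measure_pmf (map_pmf f c)) config_space (\<lambda>\<eta>. \<eta>)" for f
    by (simp add: map_pmf_rep_eq distr_distr measurable_def space_config_space comp_def)
  have "distr ?D config_space fst = blocking ?q" "distr ?D config_space snd = s6v_law C b\<^sub>1 b\<^sub>2 (\<lambda>x. x > 0) t"
    unfolding r p c_fst[symmetric] c_snd[symmetric] marginal[symmetric]
    by (simp_all add: distr_distr[OF _ swap] comp_def prod.swap_def)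
  moreover have "AE (\<eta>, \<xi>) in ?D. \<forall>x. height \<xi> x \<le> height \<eta> x"
  proof -
    \<comment> \<open>The comparison of heights is derived on the support of \<open>c\<close>, which
      is measurable as a countable set of measurable points.\<close>
    have "{z} \<in> sets ?N" for z
      using pair_measureI[OF singleton_in_config_space[of "fst z"] singleton_in_config_space[of "snd z"]] by simp
    then have "prod.swap ` set_pmf c \<in> sets ?N"
      by (rule sets.countable[OF _ countable_image[OF countable_set_pmf]])
    moreover have "{z \<in> space ?N. z \<in> prod.swap ` set_pmf c} = prod.swap ` set_pmf c"
      by (simp add: space_pair_measure space_config_space)
    ultimately have "AE z in ?D. z \<in> prod.swap ` set_pmf c"
      by (simp only: AE_distr_iff[OF swap]) (intro AE_pmfI imageI)
    then show ?thesis
    proof (rule AE_mp, intro AE_I2 impI)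
      fix z assume "z \<in> prod.swap ` set_pmf c"
      then obtain \<xi> \<eta> where "(\<xi>, \<eta>) \<in> set_pmf c" "z = (\<eta>, \<xi>)" by auto
      then show "case z of (\<eta>, \<xi>) \<Rightarrow> \<forall>x. height \<xi> x \<le> height \<eta> x"
        using c by (simp add: le_fun_def)
    qed
  qed
  moreover have "prob_space ?D" by (rule measure_pmf.prob_space_distr[OF swap])
  ultimately show ?thesis
    unfolding stoch_dominated_def using law_A prob_on_A_blocking[OF q] by (intro conjI exI[of _ ?D]) auto
qed

end
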